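(* Let $d\ge 2$ and let $F=(F_1,\dots,F_d)$ be a vector field on $\mathbb{R}^d$ each of whose components $F_k$, $k=1,\dots,d$, belongs to the Schwartz class $\mathcal{S}(\mathbb{R}^d)$. Let $\Phi=\operatorname{div}F$, $\varphi=\Phi\ast G$, $F^{\mathrm p}=\nabla\varphi$ and $F^{\mathrm s}=F-F^{\mathrm p}$, where $G$ is the fundamental solution of the Laplace equation in $\mathbb{R}^d$. Then, as $|x|\to\infty$, $$|\varphi(x)|=\mathcal{O}\left(\frac{1}{|x|^{d-1}}\right),$$ $$|F^{\mathrm p}(x)|=\mathcal{O}\left(\frac1{|x|^{d}}\right),\qquad |F^{\mathrm s}(x)|=\mathcal{O}\left(\frac1{|x|^{d}}\right),$$ $$\left|\frac{\partial}{\partial x_j}F^{\mathrm p}(x)\right|=\mathcal{O}\left(\frac1{|x|^{d+1}}\right),\qquad \left|\frac{\partial}{\partial x_j}F^{\mathrm s}(x)\right|=\mathcal{O}\left(\frac1{|x|^{d+1}}\right),$$ $$\left|\frac{\partial^2}{\partial x_j\partial x_k}F^{\mathrm p}(x)\right|=\mathcal{O}\left(\frac1{|x|^{d+2}}\right),\qquad \left|\frac{\partial^2}{\partial x_j\partial x_k}F^{\mathrm s}(x)\right|=\mathcal{O}\left(\frac1{|x|^{d+2}}\right),$$ for all $j,k=1,2,\dots,d$.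
   Context: The fundamental solution of the Laplace equation ($\Delta G=\delta$) is $G(x)=\frac1{2\pi}\ln|x|$ for $d=2$ and $G(x)=-\frac{\Gamma(d/2-1)}{4\pi^{d/2}}|x|^{2-d}$ for $d\ge3$. The convolution is $(\Phi\ast G)(x)=\int_{\mathbb{R}^d}\Phi(y)G(x-y)\,dy$. The field $F^{\mathrm p}$ is called the potential part and $F^{\mathrm s}$ the solenoidal part of $F$. *)

theory Defs
  imports "HOL-Analysis.Analysis" "HOL-Library.Landau_Symbols"
begin

definition partial_deriv :: "'n::finite \<Rightarrow> (real^'n \<Rightarrow> 'b::real_normed_vector) \<Rightarrow> real^'n \<Rightarrow> 'b" where
  "partial_deriv j f x = vector_derivative (\<lambda>t. f (x + t *\<^sub>R axis j 1)) (at 0)"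

primrec iter_partial_deriv :: "'n::finite list \<Rightarrow> (real^'n \<Rightarrow> 'b::real_normed_vector) \<Rightarrow> real^'n \<Rightarrow> 'b" where
  "iter_partial_deriv [] f = f"
| "iter_partial_deriv (j # js) f = partial_deriv j (iter_partial_deriv js f)"

text \<open>Total differentiability of all iterated partial derivatives says that the function is
  infinitely differentiable. Derivatives are indexed by lists of coordinate directions instead
  of multi-indices; for smooth functions the order of the directions is irrelevant.\<close>

definition schwartz :: "(real^'n::finite \<Rightarrow> real) \<Rightarrow> bool" where
  "schwartz f \<longleftrightarrow>
     (\<forall>js. iter_partial_deriv js f differentiable_on UNIV) \<and>
     (\<forall>(\<alpha> :: 'n \<Rightarrow> nat) js. bounded (range (\<lambda>x. (\<Prod>i\<in>UNIV. (x $ i) ^ \<alpha> i) * iter_partial_deriv js f x)))"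

definition divergence :: "(real^'n::finite \<Rightarrow> real^'n) \<Rightarrow> real^'n \<Rightarrow> real" where
  "divergence F x = (\<Sum>i\<in>UNIV. partial_deriv i (\<lambda>y. F y $ i) x)"

definition gradient :: "(real^'n::finite \<Rightarrow> real) \<Rightarrow> real^'n \<Rightarrow> real^'n" where
  "gradient f x = (\<chi> i. partial_deriv i f x)"

definition convolution :: "(real^'n::finite \<Rightarrow> real) \<Rightarrow> (real^'n \<Rightarrow> real) \<Rightarrow> real^'n \<Rightarrow> real" where
  "convolution f g x = (\<integral>y. f y * g (x - y) \<partial>lborel)"

text \<open>The sign convention is \<open>\<Delta> G = \<delta>\<close>. The formula is meant for dimension at least 2 and
  \<open>x \<noteq> 0\<close>; at the singularity it takes the value 0, which is immaterial under an integral.\<close>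

definition laplace_fundamental :: "real^'n::finite \<Rightarrow> real" where
  "laplace_fundamental x =
     (if CARD('n) = 2 then 1 / (2 * pi) * ln (norm x)
      else - (Gamma (real CARD('n) / 2 - 1) / (4 * pi powr (real CARD('n) / 2)))
             * norm x powr (2 - real CARD('n)))"

end

theory Submission
  imports Defs
begin

text \<open>
  Outside the unit ball the kernel agrees with a function \<open>G\<^sub>0\<close> of class \<open>C\<^sup>4\<close> whose derivatives of
  order \<open>1 \<le> m \<le> 4\<close> are \<open>O((1 + |z|)\<^bsup>2-d-m\<^esup>)\<close>, and the difference \<open>K\<close> is integrable with support in the
  unit ball. Derivatives of \<open>\<phi>\<close> fall on the Schwartz factor. Convolving a Schwartz function with \<open>K\<close>
  gives rapid decay. In the part with \<open>G\<^sub>0\<close> all derivatives, including the one hidden in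
  \<open>\<Phi> = div F\<close>, are moved onto \<open>G\<^sub>0\<close>, and Peetre's inequality \<open>1 + |x| \<le> (1 + |y|) (1 + |x - y|)\<close>
  transfers the decay of \<open>\<partial>\<^sup>\<alpha> G\<^sub>0\<close> to the convolution. Moving a derivative needs no integration by
  parts: differentiating \<open>u * h\<close> under the integral in both of its forms gives
  \<open>(\<partial>u) * h = \<partial>(u * h) = u * (\<partial>h)\<close>.
\<close>

section \<open>Integration\<close>

text \<open>Near the origin a derivative of order m >= 1 of the fundamental solution has size
  |x|^(2-d-m), which is not locally integrable once m >= 2. Up to four derivatives can meet the
  kernel: two from the statement, one from the gradient and one from the divergence. Leaving all of
  them on the Schwartz factor does not help either, since the kernel itself decays only like
  |x|^(2-d), and for d = 2 grows logarithmically. The splitting separates these two obstacles: the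
  power of decay is read off from a kernel without singularity, and the singular remainder enters
  only through weighted integrability. Order 0 is missing from the decay estimates because of the
  same logarithm; the derivative inside \<open>divergence F\<close>, the source of the vanishing
  mean of \<open>\<Phi>\<close>, ensures that order 0 never occurs. Since only finitely many orders
  of decay are claimed, a regular part of finite smoothness suffices, and a Taylor polynomial takes
  the place of a smooth cutoff.\<close>

lemma has_derivative_integral_dominated:
  fixes u :: "'a::{real_normed_vector, perfect_space} \<Rightarrow> 'b \<Rightarrow> real" and u' :: "'a \<Rightarrow> 'b \<Rightarrow> 'a \<Rightarrow> real"
  assumes r: "r > 0"
    and int: "\<And>x. x \<in> ball x0 r \<Longrightarrow> integrable M (u x)"
    and der: "\<And>x y. x \<in> ball x0 r \<Longrightarrow> ((\<lambda>x. u x y) has_derivative u' x y) (at x)"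
    and bnd: "\<And>x y v. x \<in> ball x0 r \<Longrightarrow> \<bar>u' x y v\<bar> \<le> w y * norm v"
    and w: "integrable M w"
  shows "((\<lambda>x. \<integral>y. u x y \<partial>M) has_derivative (\<lambda>v. \<integral>y. u' x0 y v \<partial>M)) (at x0)"
proof -
  have x0: "x0 \<in> ball x0 r" using r by simp
  have lin: "linear (u' x0 y)" for y
    using der[OF x0, of y] has_derivative_linear by blast
  \<comment> \<open>Measurability of the derivative in \<open>y\<close> comes from the difference
    quotients along \<open>v\<close>, which are measurable and converge pointwise.\<close>
  have meas: "(\<lambda>y. u' x0 y v) \<in> borel_measurable M" for v
  proof -
    \<comment> \<open>The factor r / (1 + |v|) keeps \<open>x0 + t n *\<^sub>R v\<close> inside the
      ball for every \<open>v\<close>, including 0.\<close>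
    define t where "t n = r / (1 + norm v) * inverse (real (Suc n))" for n
    have rv: "r / (1 + norm v) > 0" using r by (simp add: add_pos_nonneg)
    have tpos: "t n > 0" for n unfolding t_def by (intro mult_pos_pos rv) simp
    have t0: "t \<longlonglongrightarrow> 0" unfolding t_def
      using tendsto_mult_right_zero[OF LIMSEQ_inverse_real_of_nat] by blast
    have tr: "t n * norm v < r" for n
    proof -
      have "t n \<le> r / (1 + norm v) * 1" unfolding t_def
        using rv by (intro mult_left_mono) (auto simp: field_simps)
      hence "t n * norm v \<le> r / (1 + norm v) * norm v" by (intro mult_right_mono) auto
      also have "\<dots> < r" using r by (simp add: field_simps add_pos_nonneg)
      finally show ?thesis .
    qed
    have mem: "x0 + t n *\<^sub>R v \<in> ball x0 r" for n
      using tr[of n] tpos[of n] by (simp add: dist_norm)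
    have "(\<lambda>n. (u (x0 + t n *\<^sub>R v) y - u x0 y) / t n) \<longlonglongrightarrow> u' x0 y v" for y
    proof -
      have "((\<lambda>s. u (x0 + s *\<^sub>R v) y) has_derivative (\<lambda>s. u' x0 y (s *\<^sub>R v))) (at 0)"
        by (rule has_derivative_compose[where g="\<lambda>x. u x y" and f="\<lambda>s. x0 + s *\<^sub>R v" and f'="\<lambda>s. s *\<^sub>R v"])
           (auto intro!: derivative_eq_intros der simp: x0 r)
      hence "((\<lambda>s. u (x0 + s *\<^sub>R v) y) has_field_derivative u' x0 y v) (at 0)"
        by (rule has_derivative_imp_has_field_derivative) (simp add: linear_scale[OF lin])
      hence "((\<lambda>s. (u (x0 + s *\<^sub>R v) y - u x0 y) / s) \<longlongrightarrow> u' x0 y v) (at 0)"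
        by (simp add: DERIV_def)
      moreover have "filterlim t (at 0) sequentially"
        using t0 tpos by (simp add: filterlim_at less_imp_neq[symmetric])
      ultimately show ?thesis by (rule filterlim_compose)
    qed
    moreover have "(\<lambda>y. (u (x0 + t n *\<^sub>R v) y - u x0 y) / t n) \<in> borel_measurable M" for n
      by (intro borel_measurable_divide borel_measurable_diff borel_measurable_const
          borel_measurable_integrable int mem x0)
    ultimately show ?thesis by (rule borel_measurable_LIMSEQ_real)
  qed
  have intu': "integrable M (\<lambda>y. u' x0 y v)" for v
  proof (rule Bochner_Integration.integrable_bound)
    show "integrable M (\<lambda>y. w y * norm v)" using w by simp
    show "AE y in M. norm (u' x0 y v) \<le> norm (w y * norm v)"
      using bnd[OF x0] by (intro AE_I2) (metis abs_ge_self order_trans real_norm_def)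
  qed (rule meas)
  have bl: "bounded_linear (\<lambda>v. \<integral>y. u' x0 y v \<partial>M)"
  proof (rule bounded_linear_intro)
    show "(\<integral>y. u' x0 y (a + b) \<partial>M) = (\<integral>y. u' x0 y a \<partial>M) + (\<integral>y. u' x0 y b \<partial>M)" for a b
      using intu' by (simp add: linear_add[OF lin])
    show "(\<integral>y. u' x0 y (c *\<^sub>R a) \<partial>M) = c *\<^sub>R (\<integral>y. u' x0 y a \<partial>M)" for c a
      by (simp add: linear_scale[OF lin])
    show "norm (\<integral>y. u' x0 y v \<partial>M) \<le> norm v * (\<integral>y. w y \<partial>M)" for v
    proof -
      have "norm (\<integral>y. u' x0 y v \<partial>M) \<le> (\<integral>y. norm (u' x0 y v) \<partial>M)" by simp
      also have "\<dots> \<le> (\<integral>y. w y * norm v \<partial>M)"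
        by (rule integral_mono) (use intu' w bnd[OF x0] in auto)
      finally have "norm (\<integral>y. u' x0 y v \<partial>M) \<le> (\<integral>y. w y * norm v \<partial>M)" .
      thus ?thesis by (simp add: mult.commute)
    qed
  qed
  \<comment> \<open>The remainder quotient is tested along sequences, because dominated convergence
    is a statement about sequences.\<close>
  have "((\<lambda>x. norm ((\<integral>y. u x y \<partial>M) - (\<integral>y. u x0 y \<partial>M) - (\<integral>y. u' x0 y (x - x0) \<partial>M)) / norm (x - x0))
      \<longlongrightarrow> 0) (at x0)"
    unfolding tendsto_at_iff_sequentially
  proof (intro allI impI)
    fix X assume X: "\<forall>i. X i \<in> UNIV - {x0}" and lim: "X \<longlonglongrightarrow> x0"
    have "\<forall>\<^sub>F i in sequentially. X i \<in> ball x0 r"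
      using lim r by (intro topological_tendstoD) auto
    then obtain N where N: "\<And>i. i \<ge> N \<Longrightarrow> X i \<in> ball x0 r"
      by (auto simp: eventually_sequentially)
    define Y where "Y i = X (i + N)" for i
    have Yb: "Y i \<in> ball x0 r" and Yne: "Y i \<noteq> x0" for i using N X by (auto simp: Y_def)
    have Ylim: "Y \<longlonglongrightarrow> x0" unfolding Y_def using lim by (rule LIMSEQ_ignore_initial_segment)
    define q where "q i y = \<bar>u (Y i) y - u x0 y - u' x0 y (Y i - x0)\<bar> / norm (Y i - x0)" for i y
    have qint: "integrable M (q i)" for i
      unfolding q_def using int[OF Yb] int[OF x0] intu' by simp
    \<comment> \<open>One \<open>w y\<close> bounds the increment, by the mean value inequality on
      the convex ball; the other bounds the linear term.\<close>
    have qb: "\<bar>q i y\<bar> \<le> 2 * w y" for i y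
    proof -
      have "onorm (u' x y) \<le> w y" if "x \<in> ball x0 r" for x
        by (rule onorm_le) (use bnd[OF that] in simp)
      hence "norm (u (Y i) y - u x0 y) \<le> w y * norm (Y i - x0)"
        by (intro differentiable_bound[where S="ball x0 r" and f'="\<lambda>x. u' x y"])
           (use der Yb x0 in \<open>auto intro: has_derivative_at_withinI\<close>)
      moreover have "\<bar>u' x0 y (Y i - x0)\<bar> \<le> w y * norm (Y i - x0)" by (rule bnd[OF x0])
      ultimately have "\<bar>u (Y i) y - u x0 y - u' x0 y (Y i - x0)\<bar> \<le> 2 * w y * norm (Y i - x0)"
        by simp
      thus ?thesis using Yne[of i] by (simp add: q_def field_simps)
    qed
    have q0: "(\<lambda>i. q i y) \<longlonglongrightarrow> 0" for y
    proof -
      have "((\<lambda>x. norm (u x y - u x0 y - u' x0 y (x - x0)) / norm (x - x0)) \<longlongrightarrow> 0) (at x0)"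
        using der[OF x0, of y] by (simp add: has_derivative_iff_norm)
      moreover have "filterlim Y (at x0) sequentially"
        using Ylim Yne by (simp add: filterlim_at)
      ultimately show ?thesis unfolding q_def using filterlim_compose by fastforce
    qed
    have "(\<lambda>i. \<integral>y. q i y \<partial>M) \<longlonglongrightarrow> (\<integral>y. 0 \<partial>M)"
      by (rule integral_dominated_convergence[where w="\<lambda>y. 2 * w y"])
         (use w q0 qb borel_measurable_integrable[OF qint] in auto)
    hence qlim: "(\<lambda>i. \<integral>y. q i y \<partial>M) \<longlonglongrightarrow> 0" by simp
    define e where "e x = norm ((\<integral>y. u x y \<partial>M) - (\<integral>y. u x0 y \<partial>M) - (\<integral>y. u' x0 y (x - x0) \<partial>M)) / norm (x - x0)" for x
    have "e (Y i) \<le> (\<integral>y. q i y \<partial>M)" for i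
    proof -
      have "(\<integral>y. u (Y i) y \<partial>M) - (\<integral>y. u x0 y \<partial>M) - (\<integral>y. u' x0 y (Y i - x0) \<partial>M)
          = (\<integral>y. u (Y i) y - u x0 y - u' x0 y (Y i - x0) \<partial>M)"
        using int[OF Yb] int[OF x0] intu' by simp
      hence "norm ((\<integral>y. u (Y i) y \<partial>M) - (\<integral>y. u x0 y \<partial>M) - (\<integral>y. u' x0 y (Y i - x0) \<partial>M))
          \<le> (\<integral>y. \<bar>u (Y i) y - u x0 y - u' x0 y (Y i - x0)\<bar> \<partial>M)"
        by simp
      thus ?thesis unfolding e_def q_def by (simp add: divide_right_mono)
    qed
    hence "(\<lambda>i. e (Y i)) \<longlonglongrightarrow> 0"
      by (intro tendsto_sandwich[OF _ _ tendsto_const qlim]) (auto simp: e_def)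
    hence "(\<lambda>i. e (X i)) \<longlonglongrightarrow> 0" unfolding Y_def by (rule LIMSEQ_offset)
    thus "((\<lambda>x. norm ((\<integral>y. u x y \<partial>M) - (\<integral>y. u x0 y \<partial>M) - (\<integral>y. u' x0 y (x - x0) \<partial>M)) / norm (x - x0)) \<circ> X)
        \<longlonglongrightarrow> 0"
      by (simp add: e_def o_def)
  qed
  with bl show ?thesis by (simp add: has_derivative_iff_norm)
qed

section \<open>Reflections and the symmetry of convolution\<close>

lemma lborel_distr_reflect:
  fixes x :: "'a::euclidean_space"
  shows "distr lborel borel (\<lambda>y. x - y) = (lborel :: 'a measure)"
proof -
  have "(lborel :: 'a measure) = density (distr lborel borel (\<lambda>y. x + (-1) *\<^sub>R y)) (\<lambda>_. \<bar>-1::real\<bar>^DIM('a))"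
    by (rule lborel_affine) simp
  thus ?thesis by (simp add: density_1)
qed

lemma integrable_lborel_reflect_iff:
  fixes f :: "'a::euclidean_space \<Rightarrow> real"
  shows "integrable lborel (\<lambda>y. f (x - y)) \<longleftrightarrow> integrable lborel f"
proof -
  have *: "integrable lborel (\<lambda>y. f (x - y))" if "integrable lborel f" for f :: "'a \<Rightarrow> real"
    using integrable_distr[of "\<lambda>y. x - y" lborel borel f] that by (simp add: lborel_distr_reflect)
  from *[of f] *[of "\<lambda>y. f (x - y)"] show ?thesis by auto
qed

lemma integral_lborel_reflect:
  fixes f :: "'a::euclidean_space \<Rightarrow> real"
  shows "(\<integral>y. f (x - y) \<partial>lborel) = (\<integral>y. f y \<partial>lborel)"
proof (cases "integrable lborel f")
  case True
  hence "f \<in> borel_measurable borel" by auto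
  thus ?thesis using integral_distr[of "\<lambda>y. x - y" lborel borel f] by (simp add: lborel_distr_reflect)
next
  case False
  \<comment> \<open>Neither side is integrable, so both integrals have the default value 0.\<close>
  thus ?thesis using integrable_lborel_reflect_iff[of f x] by (simp add: not_integrable_integral_eq)
qed

text \<open>Unconditional, because reflection preserves the integral even in the divergent case,
  where its value is 0.\<close>

lemma convolution_commute: "convolution f g = convolution g f"
  using integral_lborel_reflect[of "\<lambda>y. f y * g (x - y)" x for x]
  by (auto simp: convolution_def mult.commute fun_eq_iff)

lemma integrable_convolution_commute:
  fixes f g :: "'a::euclidean_space \<Rightarrow> real"
  shows "integrable lborel (\<lambda>y. f y * g (x - y)) \<longleftrightarrow> integrable lborel (\<lambda>y. g y * f (x - y))"
  using integrable_lborel_reflect_iff[of "\<lambda>y. f y * g (x - y)" x] by (simp add: mult.commute)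

section \<open>Integrability from dyadic families of balls\<close>

text \<open>A substitute for polar coordinates: |f| is dominated by the sum of the functions
  \<open>a k * indicator (cball 0 (r k))\<close>, whose integral is the volume of the unit ball
  times the given series. The radii need not be monotone, so growing balls handle decay at infinity
  and shrinking ones a singularity at 0. The origin itself is a null set.\<close>

lemma integrable_if_bounded_on_cballs:
  fixes f :: "'a::euclidean_space \<Rightarrow> real"
  assumes [measurable]: "f \<in> borel_measurable borel"
    and cov: "\<And>z. z \<noteq> 0 \<Longrightarrow> f z \<noteq> 0 \<Longrightarrow> \<exists>k. norm z \<le> r k \<and> \<bar>f z\<bar> \<le> a k"
    and a: "\<And>k. a k \<ge> 0" and r: "\<And>k. r k \<ge> 0"
    and summ: "summable (\<lambda>k::nat. a k * r k ^ DIM('a))"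
  shows "integrable lborel f"
proof (rule integrableI_bounded)
  let ?V = "unit_ball_vol (DIM('a))"
  have "(\<integral>\<^sup>+z. ennreal (norm (f z)) \<partial>lborel)
      \<le> (\<integral>\<^sup>+z. (\<Sum>k. ennreal (a k) * indicator (cball 0 (r k)) z) \<partial>(lborel :: 'a measure))"
  proof -
    have "AE z::'a in lborel. z \<noteq> 0" by (rule AE_lborel_singleton)
    hence "AE z in lborel. ennreal (norm (f z)) \<le> (\<Sum>k. ennreal (a k) * indicator (cball 0 (r k)) z)"
    proof eventually_elim
      case (elim z)
      show ?case
      proof (cases "f z = 0")
        case False
        then obtain k where k: "norm z \<le> r k" "\<bar>f z\<bar> \<le> a k" using cov[OF elim] by blast
        have "ennreal (norm (f z)) \<le> (\<Sum>j\<in>{k}. ennreal (a j) * indicator (cball 0 (r j)) z)"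
          using k by (auto intro: ennreal_leI)
        also have "\<dots> \<le> (\<Sum>k. ennreal (a k) * indicator (cball 0 (r k)) z)"
          by (rule sum_le_suminf) auto
        finally show ?thesis .
      qed simp
    qed
    thus ?thesis by (rule nn_integral_mono_AE)
  qed
  also have "\<dots> = (\<Sum>k. ennreal (a k) * emeasure lborel (cball (0::'a) (r k)))"
  proof -
    have m: "(\<lambda>z. ennreal (a k) * indicator (cball 0 (r k)) z) \<in> borel_measurable (lborel :: 'a measure)" for k
      by (intro borel_measurable_times_ennreal borel_measurable_indicator) auto
    show ?thesis
      unfolding nn_integral_suminf[OF m] by (subst nn_integral_cmult_indicator) auto
  qed
  also have "\<dots> = (\<Sum>k. ennreal (?V * (a k * r k ^ DIM('a))))"
    using a r by (simp add: emeasure_cball ennreal_mult'[symmetric] mult_ac)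
  also have "\<dots> < \<infinity>"
    using a r summ by (subst suminf_ennreal2) (auto intro!: summable_mult)
  finally show "(\<integral>\<^sup>+z. ennreal (norm (f z)) \<partial>lborel) < \<infinity>" .
qed simp

text \<open>On the ball of radius 2^(k+1) the bound is 2^(-k(d+1)), so the terms of the series are
  2^d * 2^(-k): one power beyond the critical exponent d leaves a geometric series.\<close>

lemma integrable_decay:
  shows "integrable lborel (\<lambda>y::'a::euclidean_space. 1 / (1 + norm y) ^ Suc (DIM('a)))"
proof (rule integrable_if_bounded_on_cballs[where r="\<lambda>k. 2 ^ Suc k" and a="\<lambda>k. 1 / (2 ^ k) ^ Suc (DIM('a))"])
  let ?d = "DIM('a)"
  have "1 / (2 ^ k) ^ Suc ?d * (2 ^ Suc k) ^ ?d = 2 ^ ?d * (1/2::real) ^ k" for k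
    unfolding power_Suc power_mult_distrib by (simp add: power_one_over)
  moreover have "summable (\<lambda>k. 2 ^ ?d * (1/2::real) ^ k)"
    by (intro summable_mult summable_geometric) simp
  ultimately show "summable (\<lambda>k. 1 / (2 ^ k) ^ Suc ?d * (2 ^ Suc k) ^ ?d :: real)"
    by (simp only:)
  fix z :: 'a
  show "\<exists>k. norm z \<le> 2 ^ Suc k \<and> \<bar>1 / (1 + norm z) ^ Suc ?d\<bar> \<le> 1 / (2 ^ k) ^ Suc ?d"
  proof -
    have "\<exists>k. norm z \<le> 2 ^ Suc k \<and> 2 ^ k \<le> 1 + norm z"
    proof (cases "norm z \<le> 2")
      case True thus ?thesis by (intro exI[of _ 0]) auto
    next
      case False
      obtain n where n: "norm z \<le> 2 ^ n" using real_arch_pow[of 2 "norm z"] by (auto intro: less_imp_le)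
      \<comment> \<open>Minimality makes the bound fail at m - 1, which supplies the lower estimate
        2^(m-1) < |z|.\<close>
      define m where "m = (LEAST n. norm z \<le> 2 ^ n)"
      have m: "norm z \<le> 2 ^ m" unfolding m_def using n by (rule LeastI)
      have "m \<noteq> 0" using m False by (intro notI) auto
      then obtain k where k: "m = Suc k" by (cases m) auto
      have "\<not> norm z \<le> 2 ^ k" using not_less_Least[of k "\<lambda>n. norm z \<le> 2 ^ n"] k by (auto simp: m_def)
      thus ?thesis using m k by (intro exI[of _ k]) auto
    qed
    then obtain k where k: "norm z \<le> 2 ^ Suc k" "2 ^ k \<le> 1 + norm z" by blast
    have "1 / (1 + norm z) ^ Suc ?d \<le> 1 / (2 ^ k) ^ Suc ?d"
      using k(2) by (intro divide_left_mono power_mono) (auto simp: add_pos_nonneg)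
    with k(1) show ?thesis by (intro exI[of _ k]) (auto simp: add_nonneg_nonneg)
  qed
qed simp_all

text \<open>The exponent d - 1 is one below the critical one. Near 0 it dominates both |ln |x|| for
  d = 2 and |x|^(2-d) for d >= 3, so a single majorant serves every dimension. The balls now shrink:
  2^((k+1)(d-1)) * 2^(-kd) is geometric.\<close>

lemma integrable_singularity:
  shows "integrable lborel (\<lambda>y::'a::euclidean_space. indicator (cball 0 1) y / norm y ^ (DIM('a) - 1))"
proof (rule integrable_if_bounded_on_cballs[where r="\<lambda>k. (1/2) ^ k" and a="\<lambda>k. (2 ^ Suc k) ^ (DIM('a) - 1)"])
  obtain e where e: "DIM('a) = Suc e" using DIM_positive[where 'a='a] by (cases "DIM('a)") auto
  have "(2 ^ Suc k) ^ e * ((1/2) ^ k) ^ Suc e = 2 ^ e * (1/2::real) ^ k" for k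
  proof -
    have "(2 ^ Suc k) ^ e * ((1/2) ^ k) ^ Suc e = (2 ^ Suc k * (1/2::real) ^ k) ^ e * (1/2) ^ k"
      unfolding power_mult_distrib power_Suc[of "(1/2) ^ k"] by (simp only: mult_ac)
    also have "2 ^ Suc k * (1/2::real) ^ k = 2" by (simp add: power_one_over)
    finally show ?thesis .
  qed
  hence "(\<lambda>k. (2 ^ Suc k) ^ (DIM('a) - 1) * ((1/2) ^ k) ^ DIM('a) :: real) = (\<lambda>k. 2 ^ e * (1/2::real) ^ k)"
    by (simp only: e diff_Suc_1)
  moreover have "summable (\<lambda>k. 2 ^ e * (1/2::real) ^ k)"
    by (intro summable_mult summable_geometric) simp
  ultimately show "summable (\<lambda>k. (2 ^ Suc k) ^ (DIM('a) - 1) * ((1/2) ^ k) ^ DIM('a) :: real)"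
    by (simp only:)
  fix z :: 'a assume z: "z \<noteq> 0" and nz: "indicator (cball 0 1) z / norm z ^ (DIM('a) - 1) \<noteq> (0::real)"
  show "\<exists>k. norm z \<le> (1/2) ^ k \<and> \<bar>indicator (cball 0 1) z / norm z ^ (DIM('a) - 1)\<bar> \<le> (2 ^ Suc k) ^ (DIM('a) - 1)"
  proof -
    have le1: "norm z \<le> 1" using nz by (auto simp: indicator_def split: if_splits)
    obtain n where n: "(1/2) ^ n < norm z" using real_arch_pow_inv[of "norm z" "1/2"] z by auto
    define m where "m = (LEAST n. (1/2) ^ n < norm z)"
    have m: "(1/2) ^ m < norm z" unfolding m_def using n by (rule LeastI)
    have "m \<noteq> 0" using m le1 by (intro notI) auto
    then obtain k where k: "m = Suc k" by (cases m) auto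
    have "\<not> (1/2) ^ k < norm z" using not_less_Least[of k "\<lambda>n. (1/2) ^ n < norm z"] k by (auto simp: m_def)
    moreover have "1 / norm z \<le> 2 ^ Suc k" using m z k by (simp add: power_one_over field_simps)
    hence "(1 / norm z) ^ (DIM('a) - 1) \<le> (2 ^ Suc k) ^ (DIM('a) - 1)" by (intro power_mono) auto
    ultimately show ?thesis using le1 by (intro exI[of _ k]) (auto simp: power_one_over)
  qed
qed (intro borel_measurable_divide borel_measurable_indicator, simp_all)

section \<open>Partial derivatives and decay of Schwartz functions\<close>

lemma partial_deriv_eqI:
  assumes "(f has_derivative f') (at x)"
  shows "partial_deriv j f x = f' (axis j 1)"
proof -
  have "((\<lambda>t. f (x + t *\<^sub>R axis j 1)) has_derivative (\<lambda>t. f' (t *\<^sub>R axis j 1))) (at 0)"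
    by (rule has_derivative_compose[where g=f and f="\<lambda>t. x + t *\<^sub>R axis j 1" and f'="\<lambda>t. t *\<^sub>R axis j 1"])
       (auto intro!: derivative_eq_intros assms)
  hence "((\<lambda>t. f (x + t *\<^sub>R axis j 1)) has_vector_derivative f' (axis j 1)) (at 0)"
    using linear_scale[OF has_derivative_linear[OF assms]] by (simp add: has_vector_derivative_def)
  thus ?thesis unfolding partial_deriv_def by (rule vector_derivative_at)
qed

lemma has_derivative_partial_deriv:
  fixes f :: "real^'n::finite \<Rightarrow> 'b::real_normed_vector"
  assumes "f differentiable (at x)"
  shows "(f has_derivative (\<lambda>v. \<Sum>j\<in>UNIV. v $ j *\<^sub>R partial_deriv j f x)) (at x)"
proof -
  obtain f' where f': "(f has_derivative f') (at x)" using assms by (auto simp: differentiable_def)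
  interpret linear f' using f' by (rule has_derivative_linear)
  have "f' v = (\<Sum>j\<in>UNIV. v $ j *\<^sub>R partial_deriv j f x)" for v
  proof -
    have "f' v = f' (\<Sum>j\<in>UNIV. v $ j *\<^sub>R axis j 1)"
      using basis_expansion[of v] by (simp add: scalar_mult_eq_scaleR)
    thus ?thesis by (simp add: sum scale partial_deriv_eqI[OF f'])
  qed
  with f' show ?thesis by (metis (no_types, lifting) ext)
qed

lemma differentiable_vec:
  fixes f :: "'a::real_normed_vector \<Rightarrow> real^'m::finite"
  assumes "\<And>i. (\<lambda>x. f x $ i) differentiable (at x)"
  shows "f differentiable (at x)"
proof -
  have "(\<lambda>x. \<Sum>i\<in>UNIV. f x $ i *\<^sub>R axis i (1::real)) differentiable (at x)"
    using assms by (intro differentiable_sum differentiable_scaleR) auto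
  thus ?thesis using basis_expansion[of "f x" for x] by (simp add: scalar_mult_eq_scaleR)
qed

lemma partial_deriv_vec:
  fixes f :: "real^'n::finite \<Rightarrow> real^'m::finite"
  assumes "\<And>i. (\<lambda>x. f x $ i) differentiable (at x)"
  shows "partial_deriv j f x $ i = partial_deriv j (\<lambda>x. f x $ i) x"
proof -
  obtain f' where f': "(f has_derivative f') (at x)"
    using differentiable_vec[OF assms] by (auto simp: differentiable_def)
  have "((\<lambda>x. f x $ i) has_derivative (\<lambda>v. f' v $ i)) (at x)"
    using bounded_linear.has_derivative[OF bounded_linear_vec_nth f'] .
  from partial_deriv_eqI[OF this] partial_deriv_eqI[OF f'] show ?thesis by simp
qed

lemma partial_deriv_sum:
  assumes "\<And>i. i \<in> I \<Longrightarrow> f i differentiable (at x)"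
  shows "partial_deriv j (\<lambda>x. \<Sum>i\<in>I. f i x) x = (\<Sum>i\<in>I. partial_deriv j (f i) x)"
proof -
  have "\<forall>i. \<exists>f'. i \<in> I \<longrightarrow> (f i has_derivative f') (at x)" using assms by (auto simp: differentiable_def)
  then obtain f' where f': "\<And>i. i \<in> I \<Longrightarrow> (f i has_derivative f' i) (at x)" by metis
  have "((\<lambda>x. \<Sum>i\<in>I. f i x) has_derivative (\<lambda>v. \<Sum>i\<in>I. f' i v)) (at x)"
    using f' by (rule has_derivative_sum)
  from partial_deriv_eqI[OF this] show ?thesis by (simp add: partial_deriv_eqI[OF f'])
qed

lemma partial_deriv_add:
  assumes "f differentiable (at x)" "g differentiable (at x)"
  shows "partial_deriv j (\<lambda>x. f x + g x) x = partial_deriv j f x + partial_deriv j g x"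
proof -
  obtain f' g' where f': "(f has_derivative f') (at x)" and g': "(g has_derivative g') (at x)"
    using assms by (auto simp: differentiable_def)
  from partial_deriv_eqI[OF has_derivative_add[OF f' g']] show ?thesis
    by (simp add: partial_deriv_eqI[OF f'] partial_deriv_eqI[OF g'])
qed

lemma partial_deriv_cmult:
  fixes f :: "real^'n::finite \<Rightarrow> real"
  assumes "f differentiable (at x)"
  shows "partial_deriv j (\<lambda>x. c * f x) x = c * partial_deriv j f x"
proof -
  obtain f' where f': "(f has_derivative f') (at x)"
    using assms by (auto simp: differentiable_def)
  from partial_deriv_eqI[OF has_derivative_mult_right[OF f', of c]] show ?thesis
    by (simp add: partial_deriv_eqI[OF f'])
qed

lemma partial_deriv_diff:
  assumes "f differentiable (at x)" "g differentiable (at x)"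
  shows "partial_deriv j (\<lambda>x. f x - g x) x = partial_deriv j f x - partial_deriv j g x"
proof -
  obtain f' g' where f': "(f has_derivative f') (at x)" and g': "(g has_derivative g') (at x)"
    using assms by (auto simp: differentiable_def)
  from partial_deriv_eqI[OF has_derivative_diff[OF f' g']] show ?thesis
    by (simp add: partial_deriv_eqI[OF f'] partial_deriv_eqI[OF g'])
qed

lemma partial_deriv_mult:
  fixes f g :: "real^'n::finite \<Rightarrow> real"
  assumes "f differentiable (at x)" "g differentiable (at x)"
  shows "partial_deriv j (\<lambda>x. f x * g x) x = f x * partial_deriv j g x + partial_deriv j f x * g x"
proof -
  obtain f' g' where f': "(f has_derivative f') (at x)" and g': "(g has_derivative g') (at x)"
    using assms by (auto simp: differentiable_def)
  from partial_deriv_eqI[OF has_derivative_mult[OF f' g']] show ?thesis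
    by (simp add: partial_deriv_eqI[OF f'] partial_deriv_eqI[OF g'])
qed

lemma partial_deriv_component: "partial_deriv j (\<lambda>x. x $ i) x = (if i = j then 1 else (0::real))"
proof -
  have "((\<lambda>x. x $ i) has_derivative (\<lambda>v. v $ i)) (at x)"
    by (rule bounded_linear.has_derivative[OF bounded_linear_vec_nth has_derivative_ident])
  from partial_deriv_eqI[OF this] show ?thesis by (simp add: axis_def)
qed

lemma iter_partial_deriv_append:
  "iter_partial_deriv (js @ ks) f = iter_partial_deriv js (iter_partial_deriv ks f)"
  by (induction js) auto

text \<open>Where a derivative fails to exist, \<open>partial_deriv\<close> is an arbitrarily chosen
  value, so linearity has to be backed by differentiability at every stage of the iteration.\<close>

lemma iter_partial_deriv_sum:
  fixes f :: "'i \<Rightarrow> real^'n::finite \<Rightarrow> 'b::real_normed_vector"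
  assumes "\<And>i js x. i \<in> I \<Longrightarrow> iter_partial_deriv js (f i) differentiable (at x)"
  shows "iter_partial_deriv js (\<lambda>x. \<Sum>i\<in>I. f i x) = (\<lambda>x. \<Sum>i\<in>I. iter_partial_deriv js (f i) x)"
proof (induction js)
  case (Cons j js)
  show ?case unfolding iter_partial_deriv.simps Cons.IH by (intro ext partial_deriv_sum assms)
qed simp

lemma iter_partial_deriv_diff:
  fixes f g :: "real^'n::finite \<Rightarrow> 'b::real_normed_vector"
  assumes "\<And>js x. iter_partial_deriv js f differentiable (at x)"
    and "\<And>js x. iter_partial_deriv js g differentiable (at x)"
  shows "iter_partial_deriv js (\<lambda>x. f x - g x) = (\<lambda>x. iter_partial_deriv js f x - iter_partial_deriv js g x)"
proof (induction js)
  case (Cons j js)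
  show ?case unfolding iter_partial_deriv.simps Cons.IH by (intro ext partial_deriv_diff assms)
qed simp

section \<open>Polynomial decay and Schwartz functions\<close>

text \<open>The weight 1 + |x| turns decay at infinity into one inequality on the whole space and is
  submultiplicative, as Peetre's inequality requires. \<open>decays 0\<close> is
  boundedness.\<close>

definition decays :: "nat \<Rightarrow> ('a::real_normed_vector \<Rightarrow> real) \<Rightarrow> bool" where
  "decays k h \<longleftrightarrow> (\<exists>C. \<forall>x. \<bar>h x\<bar> * (1 + norm x) ^ k \<le> C)"

lemma decaysI: "(\<And>x. \<bar>h x\<bar> * (1 + norm x) ^ k \<le> C) \<Longrightarrow> decays k h"
  by (auto simp: decays_def)

lemma decaysE:
  assumes "decays k h"
  obtains C where "C \<ge> 0" "\<And>x. \<bar>h x\<bar> * (1 + norm x) ^ k \<le> C"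
proof -
  obtain C where C: "\<bar>h x\<bar> * (1 + norm x) ^ k \<le> C" for x using assms by (auto simp: decays_def)
  have "0 \<le> \<bar>h 0\<bar> * (1 + norm (0::'a)) ^ k" by simp
  hence "C \<ge> 0" using C[of 0] by linarith
  thus thesis using C that by blast
qed

lemma decays_add:
  assumes "decays k f" "decays k g"
  shows "decays k (\<lambda>x. f x + g x)"
proof -
  from assms(1) obtain C where C: "\<And>x. \<bar>f x\<bar> * (1 + norm x) ^ k \<le> C" by (rule decaysE) blast
  from assms(2) obtain D where D: "\<And>x. \<bar>g x\<bar> * (1 + norm x) ^ k \<le> D" by (rule decaysE) blast
  show ?thesis
  proof (rule decaysI)
    fix x
    have "\<bar>f x + g x\<bar> * (1 + norm x) ^ k \<le> (\<bar>f x\<bar> + \<bar>g x\<bar>) * (1 + norm x) ^ k"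
      by (intro mult_right_mono) auto
    thus "\<bar>f x + g x\<bar> * (1 + norm x) ^ k \<le> C + D" using C[of x] D[of x] by (simp add: algebra_simps)
  qed
qed

lemma decays_cmult: "decays k f \<Longrightarrow> decays k (\<lambda>x. c * f x)"
proof (erule decaysE)
  fix C assume C: "\<And>x. \<bar>f x\<bar> * (1 + norm x) ^ k \<le> C"
  show ?thesis
  proof (rule decaysI)
    show "\<bar>c * f x\<bar> * (1 + norm x) ^ k \<le> \<bar>c\<bar> * C" for x
      using mult_left_mono[OF C[of x], of "\<bar>c\<bar>"] by (simp add: abs_mult mult.assoc)
  qed
qed

lemma decays_diff: "decays k f \<Longrightarrow> decays k g \<Longrightarrow> decays k (\<lambda>x. f x - g x)"
  using decays_add[of k f "\<lambda>x. - 1 * g x"] decays_cmult[of k g "-1"] by simp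

lemma decays_zero: "decays k (\<lambda>x. 0)"
  by (auto simp: decays_def)

lemma decays_sum: "(\<And>i. i \<in> I \<Longrightarrow> decays k (f i)) \<Longrightarrow> decays k (\<lambda>x. \<Sum>i\<in>I. f i x)"
  by (induction I rule: infinite_finite_induct) (auto intro: decays_add decays_zero)

lemma decays_mono:
  assumes "decays k f" "l \<le> k"
  shows "decays l f"
proof -
  from assms(1) obtain C where C: "\<And>x. \<bar>f x\<bar> * (1 + norm x) ^ k \<le> C" by (rule decaysE) blast
  show ?thesis
  proof (rule decaysI)
    fix x
    have "\<bar>f x\<bar> * (1 + norm x) ^ l \<le> \<bar>f x\<bar> * (1 + norm x) ^ k"
      using assms(2) by (intro mult_left_mono power_increasing) auto
    thus "\<bar>f x\<bar> * (1 + norm x) ^ l \<le> C" using C[of x] by linarith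
  qed
qed

lemma schwartz_iter_partial_deriv:
  assumes "schwartz f"
  shows "schwartz (iter_partial_deriv ks f)"
  using assms unfolding schwartz_def iter_partial_deriv_append[symmetric] by blast

lemma schwartz_partial_deriv: "schwartz f \<Longrightarrow> schwartz (partial_deriv j f)"
  using schwartz_iter_partial_deriv[of f "[j]"] by simp

lemma schwartz_differentiable: "schwartz f \<Longrightarrow> f differentiable (at x)"
  unfolding schwartz_def by (metis UNIV_I at_within_open differentiable_on_def iter_partial_deriv.simps(1) open_UNIV)

lemma schwartz_continuous_on: "schwartz f \<Longrightarrow> continuous_on S f"
  by (meson continuous_at_imp_continuous_on differentiable_imp_continuous_within schwartz_differentiable)

lemma schwartz_measurable: "schwartz f \<Longrightarrow> f \<in> borel_measurable borel"
  by (intro borel_measurable_continuous_onI schwartz_continuous_on)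

lemma schwartz_sum:
  assumes "\<And>i. i \<in> I \<Longrightarrow> schwartz (f i)"
  shows "schwartz (\<lambda>x. \<Sum>i\<in>I. f i x)"
proof -
  have eq: "iter_partial_deriv js (\<lambda>x. \<Sum>i\<in>I. f i x) = (\<lambda>x. \<Sum>i\<in>I. iter_partial_deriv js (f i) x)" for js
    using assms schwartz_differentiable schwartz_iter_partial_deriv by (intro iter_partial_deriv_sum) blast
  have bd: "bounded (range (\<lambda>x. \<Sum>i\<in>I. h i x))" if "\<And>i. i \<in> I \<Longrightarrow> bounded (range (h i))"
    for h :: "_ \<Rightarrow> real^'b \<Rightarrow> real"
    using that by (induction I rule: infinite_finite_induct) (auto intro: bounded_plus_comp)
  have "(\<lambda>x. \<Sum>i\<in>I. iter_partial_deriv js (f i) x) differentiable_on UNIV" for js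
    using schwartz_differentiable[OF schwartz_iter_partial_deriv[OF assms]]
    by (cases "finite I") (auto simp: differentiable_on_def intro!: differentiable_sum)
  thus ?thesis unfolding schwartz_def eq sum_distrib_left
    using assms by (auto simp: schwartz_def intro!: bd)
qed

text \<open>Among the monomials in the definition, 1 and the pure powers of single coordinates
  already control the weight: (1 + |x|)^k is at most a constant times 1 plus the sum of the
  |x_i|^k.\<close>

lemma schwartz_decays:
  fixes f :: "real^'n::finite \<Rightarrow> real"
  assumes "schwartz f"
  shows "decays k f"
proof -
  have b: "bounded (range (\<lambda>x. (\<Prod>i\<in>UNIV. (x $ i) ^ \<alpha> i) * f x))" for \<alpha> :: "'n \<Rightarrow> nat"
  proof -
    have "\<forall>(\<alpha> :: 'n \<Rightarrow> nat) js. bounded (range (\<lambda>x. (\<Prod>i\<in>UNIV. (x $ i) ^ \<alpha> i) * iter_partial_deriv js f x))"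
      using assms unfolding schwartz_def by (rule conjunct2)
    from this[rule_format, of \<alpha> "[]"] show ?thesis by (simp only: iter_partial_deriv.simps)
  qed
  have "\<exists>C. \<forall>x. \<bar>f x\<bar> \<le> C"
    using b[of "\<lambda>_. 0"] by (simp add: bounded_iff)
  then obtain C0 where C0: "\<And>x. \<bar>f x\<bar> \<le> C0" by blast
  have "\<exists>C. \<forall>x. \<bar>x $ i\<bar> ^ k * \<bar>f x\<bar> \<le> C" for i
  proof -
    have "(\<Prod>j\<in>UNIV. (x $ j) ^ (if j = i then k else 0)) = (x $ i) ^ k" for x :: "real^'n"
      by (simp add: if_distrib[of "\<lambda>n. a ^ n" for a] cong: if_cong)
    thus ?thesis using b[of "\<lambda>j. if j = i then k else 0"] by (simp add: bounded_iff abs_mult power_abs)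
  qed
  then obtain C where C: "\<And>i x. \<bar>x $ i\<bar> ^ k * \<bar>f x\<bar> \<le> C i" by metis
  let ?d = "real CARD('n)"
  show ?thesis
  proof (rule decaysI)
    fix x :: "real^'n"
    \<comment> \<open>Including 1 in the maximum gives 1 + |x| <= (1 + d) b. Since b is 1 or some
      |x_i|, its k-th power is one of the summands, and no multinomial expansion arises.\<close>
    define b where "b = Max (insert 1 (range (\<lambda>i. \<bar>x $ i\<bar>)))"
    have b1: "b \<ge> 1" and bi: "\<bar>x $ i\<bar> \<le> b" for i unfolding b_def by (rule Max_ge; simp)+
    have "norm x \<le> (\<Sum>i\<in>UNIV. \<bar>x $ i\<bar>)" by (rule norm_le_l1_cart)
    also have "\<dots> \<le> (\<Sum>i\<in>(UNIV::'n set). b)" by (intro sum_mono bi)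
    finally have "1 + norm x \<le> (1 + ?d) * b" using b1 by (simp add: algebra_simps)
    hence "(1 + norm x) ^ k \<le> ((1 + ?d) * b) ^ k" by (intro power_mono) auto
    also have "\<dots> = (1 + ?d) ^ k * b ^ k" by (rule power_mult_distrib)
    also have "b ^ k \<le> 1 + (\<Sum>i\<in>UNIV. \<bar>x $ i\<bar> ^ k)"
    proof -
      have "b \<in> insert 1 (range (\<lambda>i. \<bar>x $ i\<bar>))" unfolding b_def by (rule Max_in) auto
      then consider "b = 1" | i where "b = \<bar>x $ i\<bar>" by auto
      thus ?thesis
      proof cases
        case 1 thus ?thesis by (simp add: sum_nonneg)
      next
        case (2 i)
        thus ?thesis using member_le_sum[of i UNIV "\<lambda>i. \<bar>x $ i\<bar> ^ k"] by simp
      qed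
    qed
    finally have "\<bar>f x\<bar> * (1 + norm x) ^ k \<le> \<bar>f x\<bar> * ((1 + ?d) ^ k * (1 + (\<Sum>i\<in>UNIV. \<bar>x $ i\<bar> ^ k)))"
      by (simp add: mult_left_mono)
    also have "\<dots> = (1 + ?d) ^ k * (\<bar>f x\<bar> + (\<Sum>i\<in>UNIV. \<bar>x $ i\<bar> ^ k * \<bar>f x\<bar>))"
      by (simp add: algebra_simps sum_distrib_left)
    also have "\<dots> \<le> (1 + ?d) ^ k * (C0 + (\<Sum>i\<in>UNIV. C i))"
      by (intro mult_left_mono add_mono sum_mono C0 C) auto
    finally show "\<bar>f x\<bar> * (1 + norm x) ^ k \<le> (1 + ?d) ^ k * (C0 + (\<Sum>i\<in>UNIV. C i))" .
  qed
qed

section \<open>Convolution of Schwartz and tempered functions\<close>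

text \<open>Polynomial growth measured by an integral instead of pointwise, so that kernels with an
  integrable singularity are included.\<close>

definition tempered :: "('a::euclidean_space \<Rightarrow> real) \<Rightarrow> bool" where
  "tempered h \<longleftrightarrow> h \<in> borel_measurable borel \<and> (\<exists>N. integrable lborel (\<lambda>y. h y / (1 + norm y) ^ N))"

lemma weight_le: "1 + norm x \<le> (1 + norm y) * (1 + norm (x - y :: 'a::real_normed_vector))"
proof -
  have "norm x \<le> norm y + norm (x - y)" by (rule norm_triangle_sub)
  moreover have "0 \<le> norm y * norm (x - y)" by simp
  ultimately show ?thesis unfolding distrib_left distrib_right by linarith
qed

lemma weight_le': "1 + norm y \<le> (1 + norm x) * (1 + norm (x - y :: 'a::real_normed_vector))"
  using weight_le[of y x] by (simp add: norm_minus_commute)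

text \<open>Decay of \<open>u\<close> becomes decay in \<open>y\<close> at the price of a factor
  that depends on \<open>x\<close> alone and is locally bounded. This yields dominating functions
  that are uniform for \<open>x\<close> in a ball.\<close>

lemma decays_translate_le:
  fixes u :: "'a::real_normed_vector \<Rightarrow> real"
  assumes "\<And>x. \<bar>u x\<bar> * (1 + norm x) ^ N \<le> C"
  shows "\<bar>u (x - y)\<bar> \<le> (1 + norm x) ^ N * C / (1 + norm y) ^ N"
proof -
  have "(1 + norm y) ^ N \<le> (1 + norm x) ^ N * (1 + norm (x - y)) ^ N"
    unfolding power_mult_distrib[symmetric] by (intro power_mono weight_le') auto
  hence "\<bar>u (x - y)\<bar> * (1 + norm y) ^ N \<le> \<bar>u (x - y)\<bar> * ((1 + norm x) ^ N * (1 + norm (x - y)) ^ N)"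
    by (intro mult_left_mono) auto
  also have "\<dots> = (1 + norm x) ^ N * (\<bar>u (x - y)\<bar> * (1 + norm (x - y)) ^ N)" by (simp add: mult_ac)
  also have "\<dots> \<le> (1 + norm x) ^ N * C" by (intro mult_left_mono assms) auto
  finally show ?thesis by (simp add: pos_le_divide_eq add_pos_nonneg)
qed

lemma integrable_tempered_mult_schwartz:
  fixes h :: "real^'n::finite \<Rightarrow> real"
  assumes "tempered h" "schwartz u"
  shows "integrable lborel (\<lambda>y. h y * u (x - y))"
proof -
  obtain N where hm: "h \<in> borel_measurable borel" and hN: "integrable lborel (\<lambda>y. h y / (1 + norm y) ^ N)"
    using assms(1) by (auto simp: tempered_def)
  obtain C where C: "\<And>x. \<bar>u x\<bar> * (1 + norm x) ^ N \<le> C"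
    using schwartz_decays[OF assms(2), of N] by (auto simp: decays_def)
  have um: "(\<lambda>y. u (x - y)) \<in> borel_measurable borel"
    using schwartz_measurable[OF assms(2)] by measurable
  show ?thesis
  proof (rule Bochner_Integration.integrable_bound)
    show "integrable lborel (\<lambda>y. (1 + norm x) ^ N * C * \<bar>h y / (1 + norm y) ^ N\<bar>)"
      by (intro integrable_mult_right integrable_abs hN)
    show "AE y in lborel. norm (h y * u (x - y)) \<le> norm ((1 + norm x) ^ N * C * \<bar>h y / (1 + norm y) ^ N\<bar>)"
    proof (rule AE_I2)
      fix y
      have "\<bar>h y\<bar> * \<bar>u (x - y)\<bar> \<le> \<bar>h y\<bar> * ((1 + norm x) ^ N * C / (1 + norm y) ^ N)"
        by (intro mult_left_mono decays_translate_le C) auto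
      also have "\<dots> = (1 + norm x) ^ N * C * \<bar>h y / (1 + norm y) ^ N\<bar>"
        by (simp add: abs_divide add_nonneg_nonneg)
      finally show "norm (h y * u (x - y)) \<le> norm ((1 + norm x) ^ N * C * \<bar>h y / (1 + norm y) ^ N\<bar>)"
        unfolding real_norm_def abs_mult[of "h y"] by (rule order_trans[OF _ abs_ge_self])
    qed
  qed (use hm um in measurable)
qed

lemma integrable_schwartz_mult_tempered:
  fixes h :: "real^'n::finite \<Rightarrow> real"
  assumes "tempered h" "schwartz u"
  shows "integrable lborel (\<lambda>y. u y * h (x - y))"
  using integrable_tempered_mult_schwartz[OF assms] integrable_convolution_commute by blast

text \<open>With the convolution written as the integral of \<open>h y * u (x - y)\<close>, the
  variable \<open>x\<close> occurs only in the Schwartz factor, so a singular \<open>h\<close> is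
  admissible.\<close>

lemma has_derivative_convolution_schwartz:
  fixes h :: "real^'n::finite \<Rightarrow> real"
  assumes h: "tempered h" and u: "schwartz u"
  shows "(convolution u h has_derivative (\<lambda>v. \<Sum>j\<in>UNIV. v $ j *\<^sub>R convolution (partial_deriv j u) h x)) (at x)"
proof -
  obtain N where hm: "h \<in> borel_measurable borel" and hN: "integrable lborel (\<lambda>y. h y / (1 + norm y) ^ N)"
    using h by (auto simp: tempered_def)
  have "\<exists>C. \<forall>x. \<bar>partial_deriv j u x\<bar> * (1 + norm x) ^ N \<le> C" for j
    using schwartz_decays[OF schwartz_partial_deriv[OF u], of N] by (auto simp: decays_def)
  then obtain C where C: "\<And>j x. \<bar>partial_deriv j u x\<bar> * (1 + norm x) ^ N \<le> C j" by metis
  \<comment> \<open>For x' within distance 1 of x, 1 + |x'| <= 2 + |x|; hence the base of the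
    power.\<close>
  define D where "D = (\<Sum>j\<in>UNIV. (2 + norm x) ^ N * C j)"
  have C0: "C j \<ge> 0" for j
    using C[of j 0] abs_ge_zero[of "partial_deriv j u 0"] by (simp del: abs_ge_zero)
  let ?w = "\<lambda>y. D * \<bar>h y / (1 + norm y) ^ N\<bar>"
  have "((\<lambda>x. \<integral>y. h y * u (x - y) \<partial>lborel) has_derivative
      (\<lambda>v. \<integral>y. h y * (\<Sum>j\<in>UNIV. v $ j *\<^sub>R partial_deriv j u (x - y)) \<partial>lborel)) (at x)"
  proof (rule has_derivative_integral_dominated[where r=1 and w="?w"
        and u'="\<lambda>x y v. h y * (\<Sum>j\<in>UNIV. v $ j *\<^sub>R partial_deriv j u (x - y))"])
    show "integrable lborel (\<lambda>y. h y * u (x' - y))" for x'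
      by (rule integrable_tempered_mult_schwartz[OF h u])
    show "((\<lambda>x. h y * u (x - y)) has_derivative
        (\<lambda>v. h y * (\<Sum>j\<in>UNIV. v $ j *\<^sub>R partial_deriv j u (x' - y)))) (at x')" for x' y
    proof -
      have "((\<lambda>x. u (x - y)) has_derivative (\<lambda>v. \<Sum>j\<in>UNIV. v $ j *\<^sub>R partial_deriv j u (x' - y))) (at x')"
        by (rule has_derivative_compose[where g=u and f="\<lambda>x. x - y" and f'="\<lambda>v. v",
              OF _ has_derivative_partial_deriv[OF schwartz_differentiable[OF u]]])
           (auto intro!: derivative_eq_intros)
      thus ?thesis by (rule has_derivative_mult_right)
    qed
    show "integrable lborel ?w" by (intro integrable_mult_right integrable_abs hN)
    fix x' y v assume x': "x' \<in> ball x 1"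
    have xx: "1 + norm x' \<le> 2 + norm x"
      using x' norm_triangle_ineq2[of x' x] by (simp add: dist_norm norm_minus_commute)
    have "\<bar>partial_deriv j u (x' - y)\<bar> \<le> (2 + norm x) ^ N * C j / (1 + norm y) ^ N" for j
    proof -
      have "\<bar>partial_deriv j u (x' - y)\<bar> \<le> (1 + norm x') ^ N * C j / (1 + norm y) ^ N"
        by (rule decays_translate_le[OF C])
      also have "\<dots> \<le> (2 + norm x) ^ N * C j / (1 + norm y) ^ N"
        using xx C0 by (intro divide_right_mono mult_right_mono power_mono) auto
      finally show ?thesis .
    qed
    hence "\<bar>v $ j *\<^sub>R partial_deriv j u (x' - y)\<bar> \<le> norm v * ((2 + norm x) ^ N * C j / (1 + norm y) ^ N)" for j
      unfolding real_scaleR_def abs_mult by (intro mult_mono component_le_norm_cart) auto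
    hence "\<bar>\<Sum>j\<in>UNIV. v $ j *\<^sub>R partial_deriv j u (x' - y)\<bar> \<le> (\<Sum>j\<in>UNIV. norm v * ((2 + norm x) ^ N * C j / (1 + norm y) ^ N))"
      by (intro order_trans[OF sum_abs] sum_mono)
    also have "\<dots> = norm v * (D / (1 + norm y) ^ N)"
      by (simp add: D_def sum_distrib_left sum_divide_distrib)
    finally have "\<bar>h y\<bar> * \<bar>\<Sum>j\<in>UNIV. v $ j *\<^sub>R partial_deriv j u (x' - y)\<bar> \<le> \<bar>h y\<bar> * (norm v * (D / (1 + norm y) ^ N))"
      by (intro mult_left_mono) auto
    thus "\<bar>h y * (\<Sum>j\<in>UNIV. v $ j *\<^sub>R partial_deriv j u (x' - y))\<bar> \<le> ?w y * norm v"
      by (simp add: abs_mult mult_ac)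
  qed simp
  moreover have "(\<integral>y. h y * (\<Sum>j\<in>UNIV. v $ j *\<^sub>R partial_deriv j u (x - y)) \<partial>lborel)
      = (\<Sum>j\<in>UNIV. v $ j *\<^sub>R convolution (partial_deriv j u) h x)" for v
  proof -
    have "(\<integral>y. h y * (\<Sum>j\<in>UNIV. v $ j *\<^sub>R partial_deriv j u (x - y)) \<partial>lborel)
        = (\<integral>y. (\<Sum>j\<in>UNIV. v $ j * (h y * partial_deriv j u (x - y))) \<partial>lborel)"
      by (simp add: sum_distrib_left mult_ac)
    also have "\<dots> = (\<Sum>j\<in>UNIV. v $ j * (\<integral>y. h y * partial_deriv j u (x - y) \<partial>lborel))"
      using integrable_tempered_mult_schwartz[OF h schwartz_partial_deriv[OF u]]
      by (subst Bochner_Integration.integral_sum) auto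
    finally show ?thesis by (simp add: convolution_commute[of _ h] convolution_def)
  qed
  moreover have "convolution u h = (\<lambda>x. \<integral>y. h y * u (x - y) \<partial>lborel)"
    unfolding convolution_commute[of u h] by (rule ext) (rule convolution_def)
  ultimately show ?thesis by simp
qed

text \<open>The dominating function is a multiple of |u|, so a bounded gradient of \<open>h\<close>
  is enough while \<open>h\<close> may grow. This matters for d = 2, where the regular part of the
  kernel is logarithmic at infinity.\<close>

lemma partial_deriv_convolution_kernel:
  fixes h :: "real^'n::finite \<Rightarrow> real"
  assumes h: "tempered h" and u: "schwartz u"
    and diff: "\<And>z. h differentiable (at z)" and bd: "\<And>j. decays 0 (partial_deriv j h)"
  shows "partial_deriv j (convolution u h) = convolution u (partial_deriv j h)"
proof
  fix x
  have "\<exists>C. \<forall>x. \<bar>partial_deriv j h x\<bar> \<le> C" for j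
    using bd[of j] by (simp add: decays_def)
  then obtain C where C: "\<And>j x. \<bar>partial_deriv j h x\<bar> \<le> C j" by metis
  define D where "D = (\<Sum>j\<in>UNIV. C j)"
  have ui: "integrable lborel (\<lambda>y. \<bar>u y\<bar>)"
  proof -
    \<comment> \<open>Integrability of \<open>u\<close> is the case of the constant kernel 1,
      tempered with exponent d + 1.\<close>
    have "tempered (\<lambda>_::real^'n. 1)"
      unfolding tempered_def
      by (intro conjI exI[of _ "Suc DIM(real^'n)"] borel_measurable_const) (rule integrable_decay)
    hence "integrable lborel (\<lambda>y. u y * 1)" by (rule integrable_schwartz_mult_tempered[OF _ u])
    thus ?thesis by (intro integrable_abs) (simp only: mult_1_right)
  qed
  have "((\<lambda>x. \<integral>y. u y * h (x - y) \<partial>lborel) has_derivative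
      (\<lambda>v. \<integral>y. u y * (\<Sum>j\<in>UNIV. v $ j *\<^sub>R partial_deriv j h (x - y)) \<partial>lborel)) (at x)"
  proof (rule has_derivative_integral_dominated[where r=1 and w="\<lambda>y. D * \<bar>u y\<bar>"
        and u'="\<lambda>x y v. u y * (\<Sum>j\<in>UNIV. v $ j *\<^sub>R partial_deriv j h (x - y))"])
    show "integrable lborel (\<lambda>y. u y * h (x' - y))" for x'
      by (rule integrable_schwartz_mult_tempered[OF h u])
    show "((\<lambda>x. u y * h (x - y)) has_derivative
        (\<lambda>v. u y * (\<Sum>j\<in>UNIV. v $ j *\<^sub>R partial_deriv j h (x' - y)))) (at x')" for x' y
    proof -
      have "((\<lambda>x. h (x - y)) has_derivative (\<lambda>v. \<Sum>j\<in>UNIV. v $ j *\<^sub>R partial_deriv j h (x' - y))) (at x')"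
        by (rule has_derivative_compose[where g=h and f="\<lambda>x. x - y" and f'="\<lambda>v. v",
              OF _ has_derivative_partial_deriv[OF diff]])
           (auto intro!: derivative_eq_intros)
      thus ?thesis by (rule has_derivative_mult_right)
    qed
    show "integrable lborel (\<lambda>y. D * \<bar>u y\<bar>)" by (intro integrable_mult_right ui)
    fix x' y v
    have "\<bar>v $ j *\<^sub>R partial_deriv j h (x' - y)\<bar> \<le> norm v * C j" for j
      unfolding real_scaleR_def abs_mult by (intro mult_mono component_le_norm_cart C) auto
    hence "\<bar>\<Sum>j\<in>UNIV. v $ j *\<^sub>R partial_deriv j h (x' - y)\<bar> \<le> (\<Sum>j\<in>UNIV. norm v * C j)"
      by (intro order_trans[OF sum_abs] sum_mono)
    also have "\<dots> = norm v * D"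
      by (simp add: D_def sum_distrib_left)
    finally have "\<bar>u y\<bar> * \<bar>\<Sum>j\<in>UNIV. v $ j *\<^sub>R partial_deriv j h (x' - y)\<bar> \<le> \<bar>u y\<bar> * (norm v * D)"
      by (intro mult_left_mono) auto
    thus "\<bar>u y * (\<Sum>j\<in>UNIV. v $ j *\<^sub>R partial_deriv j h (x' - y))\<bar> \<le> D * \<bar>u y\<bar> * norm v"
      by (simp add: abs_mult mult_ac)
  qed simp
  note der = partial_deriv_eqI[OF this, of j]
  have axis: "(\<Sum>i\<in>UNIV. axis j 1 $ i *\<^sub>R partial_deriv i h z) = partial_deriv j h z" for z
    by (simp add: axis_def if_distrib[of "\<lambda>a. a * b" for b] cong: if_cong)
  have "partial_deriv j (convolution u h) x
      = (\<integral>y. u y * (\<Sum>i\<in>UNIV. axis j 1 $ i *\<^sub>R partial_deriv i h (x - y)) \<partial>lborel)"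
    using der by (simp only: convolution_def[abs_def])
  thus "partial_deriv j (convolution u h) x = convolution u (partial_deriv j h) x"
    by (simp only: axis convolution_def)
qed

lemma partial_deriv_convolution_schwartz:
  fixes h :: "real^'n::finite \<Rightarrow> real"
  assumes "tempered h" "schwartz u"
  shows "partial_deriv j (convolution u h) = convolution (partial_deriv j u) h"
proof
  fix x
  from partial_deriv_eqI[OF has_derivative_convolution_schwartz[OF assms]]
  show "partial_deriv j (convolution u h) x = convolution (partial_deriv j u) h x"
    by (simp add: axis_def if_distrib[of "\<lambda>a. a * b" for b] cong: if_cong)
qed

lemma iter_partial_deriv_convolution_schwartz:
  fixes h :: "real^'n::finite \<Rightarrow> real"
  assumes "tempered h" "schwartz u"
  shows "iter_partial_deriv js (convolution u h) = convolution (iter_partial_deriv js u) h"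
proof (induction js)
  case (Cons j js)
  show ?case
    unfolding iter_partial_deriv.simps Cons.IH
    by (rule partial_deriv_convolution_schwartz[OF assms(1) schwartz_iter_partial_deriv[OF assms(2)]])
qed simp

lemma differentiable_convolution_schwartz:
  fixes h :: "real^'n::finite \<Rightarrow> real"
  assumes "tempered h" "schwartz u"
  shows "convolution u h differentiable (at x)"
  using has_derivative_convolution_schwartz[OF assms] by (auto simp: differentiable_def)

text \<open>Applied in both directions: with \<open>f\<close> Schwartz and \<open>h\<close> a
  derivative of the regular kernel, and with \<open>f\<close> the singular remainder and
  \<open>h\<close> Schwartz.\<close>

lemma decays_convolution:
  fixes f h :: "real^'n::finite \<Rightarrow> real"
  assumes f: "integrable lborel (\<lambda>y. f y * (1 + norm y) ^ k)" and h: "decays k h"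
  shows "decays k (convolution f h)"
proof -
  obtain C where C: "C \<ge> 0" "\<And>x. \<bar>h x\<bar> * (1 + norm x) ^ k \<le> C"
    by (rule decaysE[OF h]) blast
  show ?thesis
  proof (rule decaysI)
    fix x
    let ?I = "\<integral>y. C * \<bar>f y * (1 + norm y) ^ k\<bar> \<partial>lborel"
    have "\<bar>convolution f h x\<bar> * (1 + norm x) ^ k = \<bar>\<integral>y. f y * h (x - y) * (1 + norm x) ^ k \<partial>lborel\<bar>"
    proof -
      have "(\<integral>y. f y * h (x - y) * (1 + norm x) ^ k \<partial>lborel) = convolution f h x * (1 + norm x) ^ k"
        unfolding convolution_def by (rule integral_mult_left_zero)
      thus ?thesis by (simp only: abs_mult) simp
    qed
    also have "\<dots> \<le> (\<integral>y. \<bar>f y * h (x - y) * (1 + norm x) ^ k\<bar> \<partial>lborel)"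
      by (rule integral_abs_bound)
    also have "\<dots> \<le> ?I"
    \<comment> \<open>The comparison uses a nonnegative integrable majorant; it also covers an
      integrand on the left that is not integrable, whose integral is then 0.\<close>
    proof (rule integral_mono')
      show "integrable lborel (\<lambda>y. C * \<bar>f y * (1 + norm y) ^ k\<bar>)"
        by (intro integrable_mult_right integrable_abs f)
      fix y
      have "(1 + norm x) ^ k \<le> (1 + norm y) ^ k * (1 + norm (x - y)) ^ k"
        unfolding power_mult_distrib[symmetric] by (intro power_mono weight_le) auto
      hence "\<bar>f y * h (x - y)\<bar> * (1 + norm x) ^ k \<le> \<bar>f y * h (x - y)\<bar> * ((1 + norm y) ^ k * (1 + norm (x - y)) ^ k)"
        by (intro mult_left_mono) auto
      also have "\<dots> = \<bar>f y * (1 + norm y) ^ k\<bar> * (\<bar>h (x - y)\<bar> * (1 + norm (x - y)) ^ k)"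
        by (simp add: abs_mult mult_ac)
      also have "\<dots> \<le> \<bar>f y * (1 + norm y) ^ k\<bar> * C"
        by (intro mult_left_mono C) auto
      finally show "\<bar>f y * h (x - y) * (1 + norm x) ^ k\<bar> \<le> C * \<bar>f y * (1 + norm y) ^ k\<bar>"
        by (simp add: abs_mult mult_ac)
      show "0 \<le> C * \<bar>f y * (1 + norm y) ^ k\<bar>" using C by simp
    qed
    finally show "\<bar>convolution f h x\<bar> * (1 + norm x) ^ k \<le> ?I" .
  qed
qed

section \<open>Symbol classes and radial functions\<close>

text \<open>Symbols of order -k with n controlled derivatives: each derivative gains one power of
  decay. The recursion removes the innermost derivative, which is the one that arrives first when
  derivatives are moved onto \<open>h\<close>.\<close>

primrec symbol_class :: "nat \<Rightarrow> nat \<Rightarrow> (real^'n::finite \<Rightarrow> real) \<Rightarrow> bool" where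
  "symbol_class 0 k h \<longleftrightarrow> decays k h"
| "symbol_class (Suc n) k h \<longleftrightarrow>
     decays k h \<and> (\<forall>x. h differentiable (at x)) \<and> (\<forall>j. symbol_class n (Suc k) (partial_deriv j h))"

lemma symbol_class_decays: "symbol_class n k h \<Longrightarrow> decays k h"
  by (cases n) auto

lemma symbol_class_Suc_imp: "symbol_class (Suc n) k h \<Longrightarrow> symbol_class n k h"
proof (induction n arbitrary: k h)
  case (Suc n)
  have "symbol_class n (Suc k) (partial_deriv j h)" for j
    using Suc.IH[of "Suc k" "partial_deriv j h"] Suc.prems by simp
  thus ?case using Suc.prems by simp
qed simp

lemma symbol_class_add: "symbol_class n k f \<Longrightarrow> symbol_class n k g \<Longrightarrow> symbol_class n k (\<lambda>x. f x + g x)"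
proof (induction n arbitrary: k f g)
  case (Suc n)
  hence d: "f differentiable (at x)" "g differentiable (at x)" for x by auto
  have "partial_deriv j (\<lambda>x. f x + g x) = (\<lambda>x. partial_deriv j f x + partial_deriv j g x)" for j
    using d by (intro ext partial_deriv_add)
  thus ?case using Suc by (auto intro: decays_add)
qed (auto intro: decays_add)

lemma symbol_class_cmult: "symbol_class n k f \<Longrightarrow> symbol_class n k (\<lambda>x. c * f x)"
proof (induction n arbitrary: k f)
  case (Suc n)
  hence d: "f differentiable (at x)" for x by auto
  have "partial_deriv j (\<lambda>x. c * f x) = (\<lambda>x. c * partial_deriv j f x)" for j
    using d by (intro ext partial_deriv_cmult)
  thus ?case using Suc by (auto intro: decays_cmult)
qed (auto intro: decays_cmult)

lemma decays_component_mult: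
  fixes h :: "real^'n::finite \<Rightarrow> real"
  assumes "decays (Suc k) h"
  shows "decays k (\<lambda>x. x $ l * h x)"
proof -
  obtain C where C: "\<And>x. \<bar>h x\<bar> * (1 + norm x) ^ Suc k \<le> C"
    using assms unfolding decays_def by blast
  show ?thesis
  proof (rule decaysI)
    fix x :: "real^'n"
    have "\<bar>x $ l\<bar> \<le> 1 + norm x" using component_le_norm_cart[of x l] by linarith
    hence "\<bar>x $ l\<bar> * (\<bar>h x\<bar> * (1 + norm x) ^ k) \<le> (1 + norm x) * (\<bar>h x\<bar> * (1 + norm x) ^ k)"
      by (intro mult_right_mono) auto
    also have "\<dots> \<le> C" using C[of x] by (simp add: mult_ac)
    finally show "\<bar>x $ l * h x\<bar> * (1 + norm x) ^ k \<le> C" by (simp add: abs_mult mult_ac)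
  qed
qed

lemma differentiable_component: "(\<lambda>x. x $ l) differentiable (at (x :: real^'n::finite))"
  using bounded_linear.has_derivative[OF bounded_linear_vec_nth has_derivative_ident]
  unfolding differentiable_def by blast

text \<open>A coordinate factor costs one power. In the product rule x_l (partial_j h) is covered by
  induction, and the term with \<open>h\<close> itself, which already has the required decay, gives
  up one order of differentiability.\<close>

lemma symbol_class_component_mult:
  fixes h :: "real^'n::finite \<Rightarrow> real"
  shows "symbol_class n (Suc k) h \<Longrightarrow> symbol_class n k (\<lambda>x. x $ l * h x)"
proof (induction n arbitrary: k h)
  case (Suc n)
  hence d: "h differentiable (at x)" for x by auto
  have "partial_deriv j (\<lambda>x. x $ l * h x) = (\<lambda>x. x $ l * partial_deriv j h x + (if l = j then 1 else 0) * h x)" for j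
    by (rule ext) (simp add: partial_deriv_mult differentiable_component d partial_deriv_component)
  moreover have "symbol_class n (Suc k) (\<lambda>x. x $ l * partial_deriv j h x)" for j
    using Suc by simp
  moreover have "symbol_class n (Suc k) (\<lambda>x. (if l = j then 1 else 0) * h x)" for j
    by (rule symbol_class_cmult[OF symbol_class_Suc_imp[OF Suc.prems]])
  ultimately have "symbol_class n (Suc k) (partial_deriv j (\<lambda>x. x $ l * h x))" for j
    by (simp only: symbol_class_add)
  thus ?case using d Suc.prems
    by (auto intro!: decays_component_mult differentiable_mult differentiable_component)
qed (simp add: decays_component_mult)

section \<open>Radial functions and extension of their profiles\<close>

text \<open>The profile is a function of |x|^2, which is smooth at the origin, unlike |x|.\<close>

lemma
  fixes x :: "real^'n::finite"
  assumes "(g has_real_derivative g') (at (norm x ^ 2))"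
  shows partial_deriv_radial: "partial_deriv j (\<lambda>x. g (norm x ^ 2)) x = x $ j * (2 * g')"
    and differentiable_radial: "(\<lambda>x. g (norm x ^ 2)) differentiable (at x)"
proof -
  have "((\<lambda>x. norm x ^ 2) has_derivative (\<lambda>v. 2 * (x \<bullet> v))) (at x)"
    unfolding power2_norm_eq_inner
    by (auto intro!: derivative_eq_intros simp: inner_commute)
  hence "((\<lambda>x. g (norm x ^ 2)) has_derivative (\<lambda>v. g' * (2 * (x \<bullet> v)))) (at x)"
    by (rule has_derivative_compose[where g=g]) (use assms in \<open>simp add: has_field_derivative_def\<close>)
  from partial_deriv_eqI[OF this, of j] this
  show "partial_deriv j (\<lambda>x. g (norm x ^ 2)) x = x $ j * (2 * g')" "(\<lambda>x. g (norm x ^ 2)) differentiable (at x)"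
    by (auto simp: inner_axis differentiable_def)
qed

text \<open>Here \<open>\<gamma> j\<close> is the j-th derivative of the profile in s = |x|^2.
  Passing to \<open>\<gamma> (Suc j)\<close> gains two powers and the factor x_l from the chain rule
  loses one. The index starts at 1 because the profile itself may be logarithmic.\<close>

lemma symbol_class_radial:
  fixes \<gamma> :: "nat \<Rightarrow> real \<Rightarrow> real"
  assumes der: "\<And>j s. j < M \<Longrightarrow> (\<gamma> j has_real_derivative \<gamma> (Suc j) s) (at s)"
    and dec: "\<And>j. 1 \<le> j \<Longrightarrow> j \<le> M \<Longrightarrow> decays (e + 2 * j) (\<lambda>x::real^'n::finite. \<gamma> j (norm x ^ 2))"
  shows "1 \<le> j \<Longrightarrow> j + n \<le> M \<Longrightarrow> symbol_class n (e + 2 * j) (\<lambda>x::real^'n. \<gamma> j (norm x ^ 2))"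
proof (induction n arbitrary: j)
  case (Suc n)
  have d: "(\<gamma> j has_real_derivative \<gamma> (Suc j) s) (at s)" for s using der Suc.prems by simp
  have "symbol_class n (Suc (Suc (e + 2 * j))) (\<lambda>x::real^'n. 2 * \<gamma> (Suc j) (norm x ^ 2))"
    using Suc.IH[of "Suc j"] Suc.prems by (intro symbol_class_cmult) simp
  hence "symbol_class n (Suc (e + 2 * j)) (\<lambda>x::real^'n. x $ l * (2 * \<gamma> (Suc j) (norm x ^ 2)))" for l
    by (rule symbol_class_component_mult)
  moreover have "partial_deriv l (\<lambda>x::real^'n. \<gamma> j (norm x ^ 2)) = (\<lambda>x. x $ l * (2 * \<gamma> (Suc j) (norm x ^ 2)))" for l
    by (rule ext) (rule partial_deriv_radial[OF d])
  moreover have "(\<lambda>x::real^'n. \<gamma> j (norm x ^ 2)) differentiable (at x)" for x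
    by (rule differentiable_radial[OF d])
  ultimately show ?case using dec Suc.prems by simp
qed (simp add: dec)

lemma smooth_extension_below_1:
  fixes f :: "nat \<Rightarrow> real \<Rightarrow> real"
  assumes f: "\<And>j s. s > 0 \<Longrightarrow> (f j has_real_derivative f (Suc j) s) (at s)"
  obtains \<gamma> where "\<And>j s. s \<ge> 1 \<Longrightarrow> \<gamma> j s = f j s"
    and "\<And>j s. j < M \<Longrightarrow> (\<gamma> j has_real_derivative \<gamma> (Suc j) s) (at s)"
    and "\<And>j. continuous_on {0..1} (\<gamma> j)"
proof -
  \<comment> \<open>\<open>P j\<close> is the Taylor polynomial of \<open>f j\<close> at 1, cut at
    degree M - j so that differentiating \<open>P j\<close> gives exactly \<open>P (Suc j)\<close>.
    For j >= M it is constant, whence the restriction to j < M below.\<close>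
  define P where "P j s = (\<Sum>i\<le>M-j. f (j + i) 1 * (s - 1) ^ i / fact i)" for j s
  define \<gamma> where "\<gamma> j s = (if s \<in> {1..} then f j s else P j s)" for j s
  have P1: "P j 1 = f j 1" for j
    unfolding P_def by (subst sum.remove[of _ 0]) (auto simp: power_0_left)
  have Pd: "(P j has_real_derivative P (Suc j) s) (at s)" if "j < M" for j s
  proof -
    obtain m where m: "M - j = Suc m" using \<open>j < M\<close> by (metis Suc_diff_Suc)
    hence m': "M - Suc j = m" by simp
    have eq: "P j = (\<lambda>s. f j 1 + (\<Sum>i\<le>m. f (Suc j + i) 1 * (s - 1) ^ Suc i / fact (Suc i)))"
      unfolding P_def m sum.atMost_Suc_shift by simp
    have t: "((\<lambda>s. f (Suc j + i) 1 * (s - 1) ^ Suc i / fact (Suc i)) has_real_derivative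
        f (Suc j + i) 1 * (s - 1) ^ i / fact i) (at s)" for i
    proof -
      have "((\<lambda>s. (s - 1) ^ Suc i) has_real_derivative (1 + real i) * (s - 1) ^ i) (at s)"
        by (rule DERIV_cong[OF DERIV_power_Suc[OF DERIV_diff[OF DERIV_ident DERIV_const]]]) simp
      from DERIV_cdivide[OF DERIV_cmult[OF this], of "f (Suc j + i) 1" "fact (Suc i)"]
      \<comment> \<open>The factor 1 + i from the power rule cancels against the factorial.\<close>
      moreover have "a * (c * p) / (c * q) = a * p / q" if "c \<noteq> 0" for a c p q :: real
        using that by simp
      from this[of "1 + real i"]
      have "f (Suc j + i) 1 * ((1 + real i) * (s - 1) ^ i) / fact (Suc i) = f (Suc j + i) 1 * (s - 1) ^ i / fact i"
        unfolding fact_Suc of_nat_Suc by simp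
      ultimately show ?thesis by (rule DERIV_cong)
    qed
    have "((\<lambda>s. f j 1 + (\<Sum>i\<le>m. f (Suc j + i) 1 * (s - 1) ^ Suc i / fact (Suc i))) has_real_derivative
        0 + (\<Sum>i\<le>m. f (Suc j + i) 1 * (s - 1) ^ i / fact i)) (at s)"
      by (rule DERIV_add[OF DERIV_const DERIV_sum[OF t]])
    thus ?thesis unfolding eq unfolding P_def m' by simp
  qed
  show thesis
  proof
    show "\<gamma> j s = f j s" if "s \<ge> 1" for j s using that by (simp add: \<gamma>_def)
    show "(\<gamma> j has_real_derivative \<gamma> (Suc j) s) (at s)" if "j < M" for j s
    proof -
      \<comment> \<open>The two closures meet only at 1, where values and derivatives of both pieces
        agree because \<open>P j 1 = f j 1\<close> for every j.\<close>
      have cl: "closure {1::real..} = {1..}" "closure {..<1::real} = {..1}" by simp_all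
      have "((\<lambda>s. if s \<in> {1..} then f j s else P j s) has_vector_derivative
          (if s \<in> {1..} then f (Suc j) s else P (Suc j) s)) (at s within UNIV)"
        by (rule has_vector_derivative_If_within_closures[where T="{..<1}"])
           (use f[of s j] Pd[OF that, of s] P1 in \<open>auto simp: cl not_le
             simp flip: has_real_derivative_iff_has_vector_derivative intro: has_field_derivative_at_within\<close>)
      thus ?thesis unfolding \<gamma>_def[abs_def] by (simp add: has_real_derivative_iff_has_vector_derivative)
    qed
    show "continuous_on {0..1} (\<gamma> j)" for j
    proof -
      have "continuous_on {0..1} (P j)" unfolding P_def by (intro continuous_intros) auto
      moreover have "P j s = \<gamma> j s" if "s \<in> {0..1}" for s
        using that P1 by (cases "s = 1") (auto simp: \<gamma>_def)
      ultimately show ?thesis by (rule continuous_on_eq)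
    qed
  qed
qed

lemma bounded_radial_unit_ball:
  fixes g :: "real \<Rightarrow> real"
  assumes "continuous_on {0..1} g"
  obtains A where "A \<ge> 0" "\<And>x::'a::real_normed_vector. norm x \<le> 1 \<Longrightarrow> \<bar>g (norm x ^ 2)\<bar> \<le> A"
proof -
  have "bounded (g ` {0..1})"
    using assms by (intro compact_imp_bounded compact_continuous_image) auto
  then obtain A where "\<forall>y\<in>g ` {0..1}. norm y \<le> A" unfolding bounded_iff by (rule exE)
  hence A: "\<And>s. s \<in> {0..1} \<Longrightarrow> \<bar>g s\<bar> \<le> A" by simp
  have "A \<ge> 0" using A[of 0] by simp
  moreover have "\<bar>g (norm x ^ 2)\<bar> \<le> A" if "norm x \<le> 1" for x :: 'a
    using that by (intro A) (auto simp: power_le_one)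
  ultimately show thesis using that by blast
qed

lemma decays_radial:
  fixes g :: "real \<Rightarrow> real"
  assumes c: "continuous_on {0..1} g"
    and b: "\<And>s. s \<ge> 1 \<Longrightarrow> g s = b * s powr (- (real q / 2))"
  shows "decays q (\<lambda>x::'a::real_normed_vector. g (norm x ^ 2))"
proof -
  obtain A where A: "A \<ge> 0" "\<And>x::'a. norm x \<le> 1 \<Longrightarrow> \<bar>g (norm x ^ 2)\<bar> \<le> A"
    using bounded_radial_unit_ball[OF c, where 'a='a] by blast
  show ?thesis
  proof (rule decaysI)
    fix x :: 'a
    \<comment> \<open>The factor 2^q: the weight base 1 + |x| is at most 2 inside the unit ball and
      at most 2|x| outside.\<close>
    show "\<bar>g (norm x ^ 2)\<bar> * (1 + norm x) ^ q \<le> (A + \<bar>b\<bar>) * 2 ^ q"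
    proof (cases "norm x \<le> 1")
      case True
      have "\<bar>g (norm x ^ 2)\<bar> \<le> A + \<bar>b\<bar>" using A(2)[OF True] by simp
      thus ?thesis using True A by (intro mult_mono power_mono) auto
    next
      case False
      have pos: "norm x > 0" using False norm_ge_zero[of x] by linarith
      have "(norm x ^ 2) powr (- (real q / 2)) = norm x powr (- real q)"
        using False by (simp add: powr_powr flip: powr_numeral)
      also have "\<dots> = 1 / norm x ^ q" using pos by (simp add: powr_minus powr_realpow field_simps)
      finally have g: "\<bar>g (norm x ^ 2)\<bar> = \<bar>b\<bar> / norm x ^ q"
        using False b[of "norm x ^ 2"] by (simp add: abs_mult)
      have "(1 + norm x) ^ q \<le> (2 * norm x) ^ q" using False by (intro power_mono) auto
      hence "\<bar>b\<bar> / norm x ^ q * (1 + norm x) ^ q \<le> \<bar>b\<bar> / norm x ^ q * (2 * norm x) ^ q"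
        by (intro mult_left_mono) auto
      also have "\<dots> = \<bar>b\<bar> * 2 ^ q" using pos by (simp add: power_mult_distrib)
      also have "\<dots> \<le> (A + \<bar>b\<bar>) * 2 ^ q" using A by (intro mult_right_mono) auto
      finally show ?thesis unfolding g .
    qed
  qed
qed

section \<open>The fundamental solution\<close>

text \<open>In the variable s = |x|^2 both formulas have first derivative a multiple of s^(-d/2), so
  the dimensions differ only at order 0. The exponent is written as half of d - 2 + 2(j+1) to match
  the decay rate of \<open>decays_radial\<close>.\<close>

lemma laplace_fundamental_profile:
  assumes d2: "CARD('n::finite) \<ge> 2"
  obtains f :: "nat \<Rightarrow> real \<Rightarrow> real" and a :: "nat \<Rightarrow> real"
  where "\<And>j s. s > 0 \<Longrightarrow> (f j has_real_derivative f (Suc j) s) (at s)"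
    and "\<And>j s. s > 0 \<Longrightarrow> f (Suc j) s = a j * s powr (- (real (CARD('n) - 2 + 2 * Suc j) / 2))"
    and "\<And>x::real^'n. x \<noteq> 0 \<Longrightarrow> laplace_fundamental x = f 0 (norm x ^ 2)"
proof -
  let ?d = "real CARD('n)"
  define c where "c = - (Gamma (?d / 2 - 1) / (4 * pi powr (?d / 2)))"
  \<comment> \<open>The constant 1/(2 pi) is halved, since ln |x| = (ln s) / 2.\<close>
  define R where "R s = (if CARD('n) = 2 then 1 / (4 * pi) * ln s else c * s powr (1 - ?d / 2))" for s :: real
  define B where "B = (if CARD('n) = 2 then 1 / (4 * pi) else c * (1 - ?d / 2))"
  \<comment> \<open>The product collects the exponents -d/2, -d/2 - 1, ... brought down by the power
    rule.\<close>
  define a where "a i = B * (\<Prod>l<i. - ?d / 2 - real l)" for i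
  define f where "f j s = (case j of 0 \<Rightarrow> R s | Suc i \<Rightarrow> a i * s powr (- ?d / 2 - real i))" for j s
  have R': "(R has_real_derivative B * s powr (- ?d / 2)) (at s)" if "s > 0" for s
  proof (cases "CARD('n) = 2")
    case True
    have "((\<lambda>s. 1 / (4 * pi) * ln s) has_real_derivative 1 / (4 * pi) * (1 / s)) (at s)"
      using that by (intro DERIV_cmult DERIV_ln_divide)
    moreover have "s powr (- ?d / 2) = 1 / s"
      using True that by (simp add: powr_minus_divide)
    moreover have "R = (\<lambda>s. 1 / (4 * pi) * ln s)" "B = 1 / (4 * pi)"
      using True by (simp_all add: R_def[abs_def] B_def)
    ultimately show ?thesis by (simp only:)
  next
    case False
    have "((\<lambda>s. c * s powr (1 - ?d / 2)) has_real_derivative c * ((1 - ?d / 2) * s powr (1 - ?d / 2 - 1))) (at s)"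
      using that by (intro DERIV_cmult has_real_derivative_powr)
    thus ?thesis using False by (simp add: R_def[abs_def] B_def mult.assoc)
  qed
  have f0: "f 0 = R" by (simp add: f_def[abs_def])
  have fS: "f (Suc i) = (\<lambda>s. a i * s powr (- ?d / 2 - real i))" for i by (simp add: f_def[abs_def])
  show thesis
  proof
    show "(f j has_real_derivative f (Suc j) s) (at s)" if "s > 0" for j s
    proof (cases j)
      case 0
      thus ?thesis using R'[OF that] by (simp add: f0 fS a_def)
    next
      case (Suc i)
      have "((\<lambda>s. a i * s powr (- ?d / 2 - real i)) has_real_derivative
          a i * ((- ?d / 2 - real i) * s powr (- ?d / 2 - real i - 1))) (at s)"
        using that by (intro DERIV_cmult has_real_derivative_powr)
      moreover have eq: "- ?d / 2 - real i - 1 = - ?d / 2 - real (Suc i)" by simp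
      have "a i * ((- ?d / 2 - real i) * s powr (- ?d / 2 - real i - 1)) = a (Suc i) * s powr (- ?d / 2 - real (Suc i))"
        unfolding eq by (simp add: a_def mult.assoc)
      ultimately show ?thesis unfolding Suc fS by (simp only:)
    qed
    show "f (Suc j) s = a j * s powr (- (real (CARD('n) - 2 + 2 * Suc j) / 2))" for j s
    proof -
      have "- (real (CARD('n) - 2 + 2 * Suc j) / 2) = - ?d / 2 - real j"
        using d2 by (simp add: of_nat_diff field_simps)
      thus ?thesis by (simp only: fS)
    qed
    show "laplace_fundamental x = f 0 (norm x ^ 2)" if "x \<noteq> 0" for x :: "real^'n"
    proof (cases "CARD('n) = 2")
      case True
      have "ln (norm x ^ 2) = 2 * ln (norm x)" using that by (simp add: ln_realpow)
      thus ?thesis using True by (simp add: f0 R_def laplace_fundamental_def)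
    next
      case False
      have "(norm x ^ 2) powr (1 - ?d / 2) = norm x powr (2 * (1 - ?d / 2))"
        using that by (simp add: powr_powr flip: powr_numeral)
      also have "2 * (1 - ?d / 2) = 2 - ?d" by simp
      finally show ?thesis using False by (simp add: f0 R_def laplace_fundamental_def c_def)
    qed
  qed
qed

text \<open>Deliberately coarse bounds, uniform in the dimension: for the logarithm both follow from
  ln t <= t - 1, applied to 1/|x| and to |x|.\<close>

lemma laplace_fundamental_bound:
  assumes d2: "CARD('n::finite) \<ge> 2"
  obtains C where "C \<ge> 0"
    and "\<And>x::real^'n. x \<noteq> 0 \<Longrightarrow> norm x \<le> 1 \<Longrightarrow> \<bar>laplace_fundamental x\<bar> \<le> C / norm x ^ (CARD('n) - 1)"
    and "\<And>x::real^'n. norm x \<ge> 1 \<Longrightarrow> \<bar>laplace_fundamental x\<bar> \<le> C * (1 + norm x)"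
proof (cases "CARD('n) = 2")
  case True
  show thesis
  proof
    fix x :: "real^'n"
    show "\<bar>laplace_fundamental x\<bar> \<le> 1 / (2 * pi) / norm x ^ (CARD('n) - 1)" if "x \<noteq> 0" "norm x \<le> 1"
    proof -
      have "ln (1 / norm x) \<le> 1 / norm x - 1" using that by (intro ln_le_minus_one) simp
      hence "\<bar>ln (norm x)\<bar> \<le> 1 / norm x"
        using that by (simp add: ln_div)
      hence "1 / (2 * pi) * \<bar>ln (norm x)\<bar> \<le> 1 / (2 * pi) * (1 / norm x)" by (intro mult_left_mono) auto
      thus ?thesis using True by (simp add: laplace_fundamental_def abs_mult)
    qed
    show "\<bar>laplace_fundamental x\<bar> \<le> 1 / (2 * pi) * (1 + norm x)" if "norm x \<ge> 1"
    proof -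
      have "ln (norm x) \<le> norm x - 1" using that by (intro ln_le_minus_one) linarith
      hence "\<bar>ln (norm x)\<bar> \<le> 1 + norm x" using that by simp
      hence "1 / (2 * pi) * \<bar>ln (norm x)\<bar> \<le> 1 / (2 * pi) * (1 + norm x)" by (intro mult_left_mono) auto
      thus ?thesis using True by (simp add: laplace_fundamental_def abs_mult)
    qed
  qed simp
next
  case False
  define c where "c = \<bar>Gamma (real CARD('n) / 2 - 1) / (4 * pi powr (real CARD('n) / 2))\<bar>"
  have c0: "c \<ge> 0" by (simp add: c_def)
  have eq: "\<bar>laplace_fundamental x\<bar> = c * norm x powr (2 - real CARD('n))" for x :: "real^'n"
    using False by (simp add: laplace_fundamental_def c_def abs_mult)
  show thesis
  proof
    fix x :: "real^'n"
    show "\<bar>laplace_fundamental x\<bar> \<le> c / norm x ^ (CARD('n) - 1)" if "x \<noteq> 0" "norm x \<le> 1"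
    proof -
      have "norm x powr (2 - real CARD('n)) \<le> norm x powr (- real (CARD('n) - 1))"
        using that d2 by (intro powr_mono') (auto simp: of_nat_diff)
      also have "\<dots> = 1 / norm x ^ (CARD('n) - 1)"
      proof -
        have "norm x powr real (CARD('n) - 1) = norm x ^ (CARD('n) - 1)"
          using that by (intro powr_realpow) simp
        thus ?thesis unfolding powr_minus_divide by (simp only:)
      qed
      finally have "c * norm x powr (2 - real CARD('n)) \<le> c * (1 / norm x ^ (CARD('n) - 1))"
        using c0 by (rule mult_left_mono)
      thus ?thesis by (simp add: eq)
    qed
    show "\<bar>laplace_fundamental x\<bar> \<le> c * (1 + norm x)" if "norm x \<ge> 1"
    proof -
      have "norm x powr (2 - real CARD('n)) \<le> norm x powr 0"
        using that d2 by (intro powr_mono) auto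
      also have "\<dots> \<le> 1 + norm x" by simp
      finally show ?thesis unfolding eq using c0 by (rule mult_left_mono)
    qed
  qed (rule c0)
qed

lemma laplace_fundamental_measurable: "(laplace_fundamental :: real^'a::finite \<Rightarrow> real) \<in> borel_measurable borel"
proof (cases "CARD('a) = 2")
  case True
  hence eq: "laplace_fundamental = (\<lambda>x::real^'a. 1 / (2 * pi) * ln (norm x))"
    by (simp add: laplace_fundamental_def[abs_def])
  show ?thesis unfolding eq by measurable
next
  case False
  hence eq: "laplace_fundamental = (\<lambda>x::real^'a. - (Gamma (real CARD('a) / 2 - 1) / (4 * pi powr (real CARD('a) / 2)))
             * norm x powr (2 - real CARD('a)))"
    by (simp add: laplace_fundamental_def[abs_def])
  show ?thesis unfolding eq by measurable
qed

lemma tempered_linear_growth: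
  fixes h :: "'a::euclidean_space \<Rightarrow> real"
  assumes m: "h \<in> borel_measurable borel" and b: "\<And>x. \<bar>h x\<bar> \<le> C * (1 + norm x)"
  shows "tempered h"
proof -
  \<comment> \<open>One power compensates the linear growth, and d + 1 remain for
    integrability.\<close>
  let ?N = "Suc (Suc DIM('a))"
  have "integrable lborel (\<lambda>y. h y / (1 + norm y) ^ ?N)"
  proof (rule Bochner_Integration.integrable_bound)
    show "integrable lborel (\<lambda>y::'a. C * (1 / (1 + norm y) ^ Suc DIM('a)))"
      by (intro integrable_mult_right integrable_decay)
    show "AE y in lborel. norm (h y / (1 + norm y) ^ ?N) \<le> norm (C * (1 / (1 + norm y) ^ Suc DIM('a)))"
    proof (rule AE_I2)
      fix y :: 'a
      have pos: "1 + norm y > 0" by (simp add: add_pos_nonneg)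
      have "\<bar>h y\<bar> / (1 + norm y) ^ ?N \<le> C * (1 + norm y) / (1 + norm y) ^ ?N"
        by (intro divide_right_mono b) simp
      also have "\<dots> = C * (1 / (1 + norm y) ^ Suc DIM('a))"
        using pos by (simp add: power_Suc[of _ "Suc DIM('a)"] del: power_Suc)
      also have "\<dots> \<le> norm (C * (1 / (1 + norm y) ^ Suc DIM('a)))"
        unfolding real_norm_def by (rule abs_ge_self)
      finally show "norm (h y / (1 + norm y) ^ ?N) \<le> norm (C * (1 / (1 + norm y) ^ Suc DIM('a)))"
        using pos by (simp only: real_norm_def abs_divide abs_of_pos zero_less_power)
    qed
    show "(\<lambda>y. h y / (1 + norm y) ^ ?N) \<in> borel_measurable lborel" using m by simp
  qed
  thus ?thesis using m unfolding tempered_def by (intro conjI exI)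
qed

lemma tempered_add:
  fixes f g :: "'a::euclidean_space \<Rightarrow> real"
  assumes "tempered f" "tempered g"
  shows "tempered (\<lambda>x. f x + g x)"
proof -
  have mono: "integrable lborel (\<lambda>y. h y / (1 + norm y) ^ N')"
    if m: "h \<in> borel_measurable borel" and i: "integrable lborel (\<lambda>y. h y / (1 + norm y) ^ N)" and "N \<le> N'"
    for h :: "'a \<Rightarrow> real" and N N'
  proof (rule Bochner_Integration.integrable_bound[OF i])
    show "AE y in lborel. norm (h y / (1 + norm y) ^ N') \<le> norm (h y / (1 + norm y) ^ N)"
    proof (rule AE_I2)
      fix y :: 'a
      have "(1 + norm y) ^ N \<le> (1 + norm y) ^ N'" using \<open>N \<le> N'\<close> by (intro power_increasing) auto
      moreover have "0 < (1 + norm y) ^ N" by (simp add: add_pos_nonneg)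
      ultimately have "\<bar>h y\<bar> / (1 + norm y) ^ N' \<le> \<bar>h y\<bar> / (1 + norm y) ^ N"
        by (intro divide_left_mono) auto
      thus "norm (h y / (1 + norm y) ^ N') \<le> norm (h y / (1 + norm y) ^ N)"
        by (simp add: abs_divide power_abs)
    qed
    show "(\<lambda>y. h y / (1 + norm y) ^ N') \<in> borel_measurable lborel" using m by simp
  qed
  obtain N where fm: "f \<in> borel_measurable borel" and fN: "integrable lborel (\<lambda>y. f y / (1 + norm y) ^ N)"
    using assms(1) unfolding tempered_def by blast
  obtain N' where gm: "g \<in> borel_measurable borel" and gN: "integrable lborel (\<lambda>y. g y / (1 + norm y) ^ N')"
    using assms(2) unfolding tempered_def by blast
  have "integrable lborel (\<lambda>y. f y / (1 + norm y) ^ (N + N') + g y / (1 + norm y) ^ (N + N'))"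
    by (intro Bochner_Integration.integrable_add mono[OF fm fN] mono[OF gm gN]) auto
  hence "integrable lborel (\<lambda>y. (f y + g y) / (1 + norm y) ^ (N + N'))"
    by (simp only: add_divide_distrib)
  moreover have "(\<lambda>x. f x + g x) \<in> borel_measurable borel" using fm gm by simp
  ultimately show ?thesis unfolding tempered_def by blast
qed

text \<open>The weight is itself tempered, and the integrand is that of its convolution with
  \<open>u\<close> at the point 0.\<close>

lemma integrable_schwartz_weight:
  fixes u :: "real^'n::finite \<Rightarrow> real"
  assumes "schwartz u"
  shows "integrable lborel (\<lambda>y. u y * (1 + norm y) ^ k)"
proof -
  let ?N = "Suc (DIM(real^'n))"
  have "(1 + norm y) ^ k / (1 + norm y) ^ (?N + k) = 1 / (1 + norm y) ^ ?N" for y :: "real^'n"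
  proof -
    have "1 + norm y \<noteq> 0" using norm_ge_zero[of y] by linarith
    thus ?thesis unfolding power_add by simp
  qed
  hence "integrable lborel (\<lambda>y::real^'n. (1 + norm y) ^ k / (1 + norm y) ^ (?N + k))"
    using integrable_decay[where 'a="real^'n"] by (simp only:)
  moreover have "(\<lambda>y::real^'n. (1 + norm y) ^ k) \<in> borel_measurable borel" by simp
  ultimately have "tempered (\<lambda>y::real^'n. (1 + norm y) ^ k)"
    unfolding tempered_def by (intro conjI exI)
  from integrable_schwartz_mult_tempered[OF this assms, of 0]
  show ?thesis by (simp only: diff_0 norm_minus_cancel)
qed

text \<open>Each induction step moves the outermost derivative of the Schwartz factor onto
  \<open>h\<close>, trading one order of the symbol class for one power of decay. When the list is
  exhausted, the convolution with \<open>u\<close> preserves the decay reached.\<close>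

lemma decays_convolution_iter_partial_deriv:
  assumes u: "schwartz u"
  shows "symbol_class n k h \<Longrightarrow> length js \<le> n \<Longrightarrow>
    decays (k + length js) (convolution (iter_partial_deriv js u) h)"
proof (induction js arbitrary: n k h)
  case Nil
  thus ?case using decays_convolution[OF integrable_schwartz_weight[OF u] symbol_class_decays] by simp
next
  case (Cons j js)
  then obtain m where n: "n = Suc m" and m: "length js \<le> m" by (cases n) auto
  have d: "\<And>x. h differentiable (at x)" and s: "\<And>i. symbol_class m (Suc k) (partial_deriv i h)"
    and hk: "decays k h" using Cons.prems(1) by (auto simp: n)
  have bd: "decays 0 (partial_deriv i h)" for i
    by (rule decays_mono[OF symbol_class_decays[OF s]]) simp
  have "decays 0 h" by (rule decays_mono[OF hk]) simp
  then obtain C where C0: "C \<ge> 0" and "\<And>x. \<bar>h x\<bar> * (1 + norm x) ^ 0 \<le> C" by (rule decaysE) blast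
  hence C: "\<bar>h x\<bar> \<le> C" for x by simp
  have t: "tempered h"
  proof (rule tempered_linear_growth)
    show "h \<in> borel_measurable borel"
      by (intro borel_measurable_continuous_onI continuous_at_imp_continuous_on ballI
          differentiable_imp_continuous_within d)
    show "\<bar>h x\<bar> \<le> C * (1 + norm x)" for x
      using C[of x] mult_left_mono[of 1 "1 + norm x" C] C0 by simp
  qed
  have us: "schwartz (iter_partial_deriv js u)" by (rule schwartz_iter_partial_deriv[OF u])
  have "convolution (iter_partial_deriv (j # js) u) h = convolution (iter_partial_deriv js u) (partial_deriv j h)"
    unfolding iter_partial_deriv.simps partial_deriv_convolution_schwartz[OF t us, symmetric]
    by (rule partial_deriv_convolution_kernel[OF t us d bd])
  thus ?case using Cons.IH[OF s m] by simp
qed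

text \<open>The regular part is \<open>G\<close> with its radial profile replaced, inside the unit ball, by a Taylor
  polynomial at \<open>1\<close> in the variable \<open>|x|\<^sup>2\<close>.\<close>

lemma laplace_fundamental_split:
  assumes d2: "CARD('n::finite) \<ge> 2"
  obtains G K :: "real^'n \<Rightarrow> real"
  where "\<And>x. laplace_fundamental x = G x + K x"
    and "\<And>N. integrable lborel (\<lambda>y. K y * (1 + norm y) ^ N)" and "tempered K"
    and "tempered G" and "\<And>x. G differentiable (at x)"
    and "\<And>j. symbol_class m (CARD('n) - 1) (partial_deriv j G)"
proof -
  let ?d = "CARD('n)" and ?\<Gamma> = "laplace_fundamental :: real^'n \<Rightarrow> real"
  obtain f :: "nat \<Rightarrow> real \<Rightarrow> real" and a :: "nat \<Rightarrow> real" where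
    f: "\<And>j s. s > 0 \<Longrightarrow> (f j has_real_derivative f (Suc j) s) (at s)" and
    fS: "\<And>j s. s > 0 \<Longrightarrow> f (Suc j) s = a j * s powr (- (real (?d - 2 + 2 * Suc j) / 2))" and
    f0: "\<And>x::real^'n. x \<noteq> 0 \<Longrightarrow> laplace_fundamental x = f 0 (norm x ^ 2)"
    using laplace_fundamental_profile[OF d2] by metis
  \<comment> \<open>Order \<open>Suc m\<close>: one derivative is spent on
    \<open>partial_deriv j G\<close>, which must admit m more.\<close>
  obtain \<gamma> where
    \<gamma>1: "\<And>j s. s \<ge> 1 \<Longrightarrow> \<gamma> j s = f j s" and
    \<gamma>': "\<And>j s. j < Suc m \<Longrightarrow> (\<gamma> j has_real_derivative \<gamma> (Suc j) s) (at s)" and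
    \<gamma>c: "\<And>j. continuous_on {0..1} (\<gamma> j)"
    using smooth_extension_below_1[of f "Suc m", OF f] by metis
  define G where "G x = \<gamma> 0 (norm x ^ 2)" for x :: "real^'n"
  define K where "K x = laplace_fundamental x - G x" for x
  have K0: "K x = 0" if "norm x \<ge> 1" for x
    using that f0[of x] \<gamma>1[of "norm x ^ 2" 0] by (cases "x = 0") (auto simp: K_def G_def)
  obtain A where A: "A \<ge> 0" "\<And>x. norm x \<le> 1 \<Longrightarrow> \<bar>G x\<bar> \<le> A"
    unfolding G_def using bounded_radial_unit_ball[OF \<gamma>c[of 0], where 'a="real^'n"] by metis
  obtain C where C: "C \<ge> 0"
    "\<And>x::real^'n. x \<noteq> 0 \<Longrightarrow> norm x \<le> 1 \<Longrightarrow> \<bar>laplace_fundamental x\<bar> \<le> C / norm x ^ (?d - 1)"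
    "\<And>x::real^'n. norm x \<ge> 1 \<Longrightarrow> \<bar>laplace_fundamental x\<bar> \<le> C * (1 + norm x)"
    using laplace_fundamental_bound[OF d2] by metis
  have \<gamma>0: "(\<gamma> 0 has_real_derivative \<gamma> (Suc 0) s) (at s)" for s by (rule \<gamma>') simp
  have Gd: "G differentiable (at x)" for x
    unfolding G_def[abs_def] by (rule differentiable_radial[OF \<gamma>0])
  have Gm: "G \<in> borel_measurable borel"
    by (intro borel_measurable_continuous_onI continuous_at_imp_continuous_on ballI
        differentiable_imp_continuous_within Gd)
  have Gt: "tempered G"
  proof (rule tempered_linear_growth[OF Gm])
    fix x
    show "\<bar>G x\<bar> \<le> (A + C) * (1 + norm x)"
    proof (cases "norm x \<le> 1")
      case True
      have "A * 1 \<le> (A + C) * (1 + norm x)" using A(1) C(1) by (intro mult_mono) auto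
      thus ?thesis using A(2)[OF True] by linarith
    next
      case False
      have "\<bar>G x\<bar> \<le> C * (1 + norm x)" using C(3)[of x] K0[of x] False by (simp add: K_def)
      also have "\<dots> \<le> (A + C) * (1 + norm x)" using A(1) by (intro mult_right_mono) auto
      finally show ?thesis .
    qed
  qed
  have Km: "K \<in> borel_measurable borel"
    unfolding K_def[abs_def] using Gm laplace_fundamental_measurable by (rule borel_measurable_diff[rotated])
  have Ki: "integrable lborel (\<lambda>y. K y * (1 + norm y) ^ N)" for N
  proof (rule Bochner_Integration.integrable_bound)
    show "integrable lborel (\<lambda>y::real^'n. (C + A) * 2 ^ N * (indicator (cball 0 1) y / norm y ^ (?d - 1)))"
      using integrable_singularity[where 'a="real^'n"] by (intro integrable_mult_right) simp
    show "(\<lambda>y. K y * (1 + norm y) ^ N) \<in> borel_measurable lborel" using Km by simp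
    have "AE y::real^'n in lborel. y \<noteq> 0" by (rule AE_lborel_singleton)
    thus "AE y in lborel. norm (K y * (1 + norm y) ^ N)
        \<le> norm ((C + A) * 2 ^ N * (indicator (cball 0 1) y / norm y ^ (?d - 1)))"
    proof eventually_elim
      case (elim y)
      show ?case
      proof (cases "norm y \<ge> 1")
        case True thus ?thesis by (simp add: K0)
      next
        case False
        hence y: "norm y \<le> 1" by simp
        \<comment> \<open>Since |y| <= 1, the bound on the regular part is absorbed into the
          singular majorant.\<close>
        have "A * norm y ^ (?d - 1) \<le> A * 1" using A(1) y by (intro mult_left_mono power_le_one) auto
        hence "A \<le> A / norm y ^ (?d - 1)" using elim by (simp add: pos_le_divide_eq)
        hence "\<bar>K y\<bar> \<le> C / norm y ^ (?d - 1) + A / norm y ^ (?d - 1)"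
          using A(2)[OF y] C(2)[OF elim y] unfolding K_def by linarith
        also have "\<dots> = (C + A) * (1 / norm y ^ (?d - 1))" by (simp add: add_divide_distrib)
        finally have "\<bar>K y\<bar> * (1 + norm y) ^ N \<le> (C + A) * (1 / norm y ^ (?d - 1)) * 2 ^ N"
          using y A(1) C(1) by (intro mult_mono power_mono) auto
        also have "\<dots> = (C + A) * 2 ^ N * (indicator (cball 0 1) y / norm y ^ (?d - 1))" using y by simp
        finally have *: "\<bar>K y\<bar> * (1 + norm y) ^ N \<le> (C + A) * 2 ^ N * (indicator (cball 0 1) y / norm y ^ (?d - 1))" .
        have "norm (K y * (1 + norm y) ^ N) = \<bar>K y\<bar> * (1 + norm y) ^ N" by (simp add: abs_mult)
        thus ?thesis using order_trans[OF * abs_ge_self] by (simp only: real_norm_def)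
      qed
    qed
  qed
  have Kt: "tempered K"
    unfolding tempered_def using Km Ki[of 0] by (intro conjI exI[of _ 0]) simp_all
  have dec: "decays (?d - 2 + 2 * j) (\<lambda>x::real^'n. \<gamma> j (norm x ^ 2))" if j: "1 \<le> j" for j
  proof -
    obtain i where i: "j = Suc i" using j by (cases j) auto
    show ?thesis unfolding i by (rule decays_radial[OF \<gamma>c, of _ "a i"]) (simp only: \<gamma>1 fS)
  qed
  \<comment> \<open>For j = 1 the exponent is (d - 2) + 2 = d; the factor x_j from the chain rule
    then leaves d - 1.\<close>
  have "symbol_class m (Suc (?d - 1)) (\<lambda>x::real^'n. \<gamma> 1 (norm x ^ 2))"
    using symbol_class_radial[of "Suc m" \<gamma> "?d - 2", OF \<gamma>' dec, of 1 m] d2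
    by (simp add: numeral_2_eq_2 Suc_diff_Suc)
  hence "symbol_class m (?d - 1) (\<lambda>x::real^'n. x $ j * (2 * \<gamma> 1 (norm x ^ 2)))" for j
    by (intro symbol_class_component_mult symbol_class_cmult)
  moreover have "partial_deriv j G = (\<lambda>x. x $ j * (2 * \<gamma> 1 (norm x ^ 2)))" for j
    unfolding G_def[abs_def] by (rule ext) (rule partial_deriv_radial, simp add: \<gamma>')
  ultimately have "symbol_class m (?d - 1) (partial_deriv j G)" for j by (simp only:)
  with Ki Kt Gt Gd show thesis by (intro that[of G K]) (auto simp: K_def)
qed

section \<open>Decay of the potential\<close>

lemma convolution_add_kernel:
  assumes "tempered G" "tempered K" "schwartz u"
  shows "convolution u (\<lambda>x. G x + K x) x = convolution u G x + convolution u K x"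
  unfolding convolution_def distrib_left
  by (intro Bochner_Integration.integral_add integrable_schwartz_mult_tempered assms)

lemma convolution_sum:
  assumes "tempered G" "\<And>i. i \<in> I \<Longrightarrow> schwartz (u i)"
  shows "convolution (\<lambda>x. \<Sum>i\<in>I. u i x) G x = (\<Sum>i\<in>I. convolution (u i) G x)"
  unfolding convolution_def sum_distrib_right
  by (intro Bochner_Integration.integral_sum integrable_schwartz_mult_tempered assms)

section \<open>Smooth functions with decaying derivatives and the passage to vector fields\<close>

text \<open>Differentiability is required at all orders, because the derivatives fall on the
  Schwartz factor; decay only up to order m, because the regular kernel has finite
  smoothness.\<close>

definition smooth_decay :: "nat \<Rightarrow> nat \<Rightarrow> (real^'n::finite \<Rightarrow> real) \<Rightarrow> bool" where
  "smooth_decay m p f \<longleftrightarrow> (\<forall>js x. iter_partial_deriv js f differentiable (at x)) \<and>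
     (\<forall>js. length js \<le> m \<longrightarrow> decays (p + length js) (iter_partial_deriv js f))"

lemma smooth_decay_schwartz: "schwartz f \<Longrightarrow> smooth_decay m p f"
  unfolding smooth_decay_def
  by (intro conjI allI impI schwartz_decays schwartz_differentiable schwartz_iter_partial_deriv)

lemma smooth_decay_diff:
  assumes "smooth_decay m p f" "smooth_decay m p g"
  shows "smooth_decay m p (\<lambda>x. f x - g x)"
proof -
  have "iter_partial_deriv js (\<lambda>x. f x - g x) = (\<lambda>x. iter_partial_deriv js f x - iter_partial_deriv js g x)" for js
    using assms by (intro iter_partial_deriv_diff) (auto simp: smooth_decay_def)
  thus ?thesis using assms by (auto simp: smooth_decay_def intro: decays_diff)
qed

lemma smooth_decay_partial_deriv:
  assumes "smooth_decay (Suc m) p f"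
  shows "smooth_decay m (Suc p) (partial_deriv j f)"
proof -
  have eq: "iter_partial_deriv js (partial_deriv j f) = iter_partial_deriv (js @ [j]) f" for js
    by (simp add: iter_partial_deriv_append)
  have "decays (Suc p + length js) (iter_partial_deriv (js @ [j]) f)" if "length js \<le> m" for js
  proof -
    have "length (js @ [j]) \<le> Suc m" using that by simp
    hence "decays (p + length (js @ [j])) (iter_partial_deriv (js @ [j]) f)"
      using assms unfolding smooth_decay_def by blast
    thus ?thesis by simp
  qed
  thus ?thesis using assms unfolding smooth_decay_def eq by blast
qed

lemma iter_partial_deriv_vec:
  fixes V :: "real^'n::finite \<Rightarrow> real^'m::finite"
  assumes "\<And>i js x. iter_partial_deriv js (\<lambda>x. V x $ i) differentiable (at x)"
  shows "iter_partial_deriv js V x $ i = iter_partial_deriv js (\<lambda>x. V x $ i) x"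
proof (induction js arbitrary: x i)
  case (Cons j js)
  have eq: "(\<lambda>x. iter_partial_deriv js V x $ i) = iter_partial_deriv js (\<lambda>x. V x $ i)" for i
    by (rule ext) (rule Cons.IH)
  have "partial_deriv j (iter_partial_deriv js V) x $ i = partial_deriv j (\<lambda>x. iter_partial_deriv js V x $ i) x"
    by (rule partial_deriv_vec) (simp only: eq assms)
  thus ?case by (simp only: iter_partial_deriv.simps eq)
qed simp

lemma decays_vec_bigo:
  fixes V :: "'a::real_normed_vector \<Rightarrow> real^'m::finite"
  assumes "\<And>i. decays k (\<lambda>x. V x $ i)"
  shows "(\<lambda>x. norm (V x)) \<in> O[at_infinity](\<lambda>x. 1 / norm x ^ k)"
proof -
  have "\<exists>C. \<forall>x. \<bar>V x $ i\<bar> * (1 + norm x) ^ k \<le> C" for i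
    using assms[of i] by (simp only: decays_def)
  then obtain C where C: "\<And>i x. \<bar>V x $ i\<bar> * (1 + norm x) ^ k \<le> C i" by metis
  have "norm (norm (V x)) \<le> (\<Sum>i\<in>UNIV. C i) * norm (1 / norm x ^ k)" if "1 \<le> norm x" for x
  proof -
    have pos: "0 < norm x ^ k" using that by (intro zero_less_power) linarith
    have "norm (V x) * norm x ^ k \<le> (\<Sum>i\<in>UNIV. \<bar>V x $ i\<bar>) * (1 + norm x) ^ k"
      by (intro mult_mono norm_le_l1_cart power_mono sum_nonneg) auto
    also have "\<dots> \<le> (\<Sum>i\<in>UNIV. C i)"
      unfolding sum_distrib_right by (intro sum_mono C)
    finally show ?thesis using pos by (simp add: pos_le_divide_eq)
  qed
  hence "eventually (\<lambda>x. norm (norm (V x)) \<le> (\<Sum>i\<in>UNIV. C i) * norm (1 / norm x ^ k)) at_infinity"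
    unfolding eventually_at_infinity by blast
  thus ?thesis by (rule bigoI)
qed

lemma decays_bigo:
  fixes h :: "'a::real_normed_vector \<Rightarrow> real"
  assumes "decays k h"
  shows "(\<lambda>x. \<bar>h x\<bar>) \<in> O[at_infinity](\<lambda>x. 1 / norm x ^ k)"
proof -
  have "(\<lambda>x. norm (vec (h x) :: real^1)) \<in> O[at_infinity](\<lambda>x. 1 / norm x ^ k)"
    using assms by (intro decays_vec_bigo) simp
  thus ?thesis by (simp add: norm_vec_def L2_set_def vec_def)
qed

lemma
  fixes V :: "real^'n::finite \<Rightarrow> real^'m::finite"
  assumes V: "\<And>i. smooth_decay m p (\<lambda>x. V x $ i)"
  shows smooth_decay_vec_differentiable: "iter_partial_deriv js V differentiable_on UNIV"
    and smooth_decay_vec_bigo: "length js \<le> m \<Longrightarrow>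
      (\<lambda>x. norm (iter_partial_deriv js V x)) \<in> O[at_infinity](\<lambda>x. 1 / norm x ^ (p + length js))"
proof -
  have d: "iter_partial_deriv js (\<lambda>x. V x $ i) differentiable (at x)" for i js x
    using V unfolding smooth_decay_def by blast
  have eq: "(\<lambda>x. iter_partial_deriv js V x $ i) = iter_partial_deriv js (\<lambda>x. V x $ i)" for i
    by (rule ext) (rule iter_partial_deriv_vec[OF d])
  have "iter_partial_deriv js V differentiable (at x)" for x
    by (rule differentiable_vec) (simp only: eq d)
  thus "iter_partial_deriv js V differentiable_on UNIV"
    by (simp add: differentiable_on_def)
  assume "length js \<le> m"
  hence "decays (p + length js) (\<lambda>x. iter_partial_deriv js V x $ i)" for i
    unfolding eq using V[of i] unfolding smooth_decay_def by blast
  thus "(\<lambda>x. norm (iter_partial_deriv js V x)) \<in> O[at_infinity](\<lambda>x. 1 / norm x ^ (p + length js))"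
    by (rule decays_vec_bigo)
qed

lemma tempered_laplace_fundamental:
  assumes "CARD('n::finite) \<ge> 2"
  shows "tempered (laplace_fundamental :: real^'n \<Rightarrow> real)"
proof -
  obtain G K :: "real^'n \<Rightarrow> real" where
    GK: "\<And>x. laplace_fundamental x = G x + K x" "tempered K" "tempered G"
    using laplace_fundamental_split[OF assms] by metis
  have "laplace_fundamental = (\<lambda>x. G x + K x)" by (rule ext) (rule GK)
  thus ?thesis using tempered_add[OF GK(3,2)] by (simp only:)
qed

text \<open>Every derivative of the divergence carries at least one derivative that can be moved onto the
  regular part of the kernel, where it gains one power of decay.\<close>

lemma smooth_decay_divergence_potential:
  fixes F :: "real^'n::finite \<Rightarrow> real^'n"
  assumes d2: "CARD('n) \<ge> 2" and F: "\<And>k. schwartz (\<lambda>x. F x $ k)"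
  shows "smooth_decay m (CARD('n) - 1) (convolution (divergence F) laplace_fundamental)"
proof -
  let ?L = "laplace_fundamental :: real^'n \<Rightarrow> real" and ?d = "CARD('n)"
  let ?f = "\<lambda>i x. F x $ i"
  obtain G K :: "real^'n \<Rightarrow> real" where
    L: "\<And>x. laplace_fundamental x = G x + K x" and
    Ki: "\<And>N. integrable lborel (\<lambda>y. K y * (1 + norm y) ^ N)" and
    Kt: "tempered K" and Gt: "tempered G" and Gd: "\<And>x. G differentiable (at x)" and
    Gs: "\<And>j. symbol_class m (?d - 1) (partial_deriv j G)"
    by (rule laplace_fundamental_split[OF d2, where m=m]) (rule that)
  have Leq: "?L = (\<lambda>x. G x + K x)" by (rule ext) (rule L)
  have Lt: "tempered ?L" by (rule tempered_laplace_fundamental[OF d2])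
  have Fs: "schwartz (iter_partial_deriv js (?f i))" for js i
    by (rule schwartz_iter_partial_deriv[OF F])
  have div: "divergence F = (\<lambda>x. \<Sum>i\<in>UNIV. partial_deriv i (?f i) x)"
    by (simp add: divergence_def[abs_def])
  have \<Phi>: "schwartz (divergence F)"
    unfolding div by (intro schwartz_sum schwartz_partial_deriv F)
  have iter\<Phi>: "iter_partial_deriv js (divergence F) = (\<lambda>x. \<Sum>i\<in>UNIV. iter_partial_deriv (js @ [i]) (?f i) x)" for js
    unfolding div iter_partial_deriv_append iter_partial_deriv.simps
    by (intro iter_partial_deriv_sum schwartz_differentiable schwartz_iter_partial_deriv schwartz_partial_deriv F)
  have iter: "iter_partial_deriv js (convolution (divergence F) ?L) = convolution (iter_partial_deriv js (divergence F)) ?L" for js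
    by (rule iter_partial_deriv_convolution_schwartz[OF Lt \<Phi>])
  have "decays (?d - 1 + length js) (iter_partial_deriv js (convolution (divergence F) ?L))"
    if len: "length js \<le> m" for js
  proof -
    let ?u = "iter_partial_deriv js (divergence F)" and ?q = "?d - 1 + length js"
    have u: "schwartz ?u" by (rule schwartz_iter_partial_deriv[OF \<Phi>])
    \<comment> \<open>The remainder plays the weighted integrable factor, and the Schwartz function
      supplies decay of any order.\<close>
    have "decays ?q (convolution ?u K)"
      unfolding convolution_commute[of ?u K] by (rule decays_convolution[OF Ki schwartz_decays[OF u]])
    moreover have "decays ?q (convolution ?u G)"
    proof -
      have "decays ?q (convolution (iter_partial_deriv (js @ [i]) (?f i)) G)" for i
      proof -
        \<comment> \<open>Only the outermost derivative can be split off, while the one from the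
          divergence is innermost. As \<open>js @ [i]\<close> is nonempty, its head is moved
          instead, so mixed partial derivatives never have to be interchanged.\<close>
        obtain j ks where jk: "js @ [i] = j # ks" by (cases "js @ [i]") auto
        have ks: "length ks = length js" using arg_cong[OF jk, of length] by simp
        have "decays 0 (partial_deriv j G)" for j
          by (rule decays_mono[OF symbol_class_decays[OF Gs]]) simp
        hence "partial_deriv j (convolution (iter_partial_deriv ks (?f i)) G)
            = convolution (iter_partial_deriv ks (?f i)) (partial_deriv j G)"
          by (rule partial_deriv_convolution_kernel[OF Gt Fs Gd])
        hence "convolution (iter_partial_deriv (js @ [i]) (?f i)) G
            = convolution (iter_partial_deriv ks (?f i)) (partial_deriv j G)"
          unfolding jk iter_partial_deriv.simps partial_deriv_convolution_schwartz[OF Gt Fs] .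
        thus ?thesis
          using decays_convolution_iter_partial_deriv[OF F Gs, of ks i j] len ks by simp
      qed
      hence "decays ?q (\<lambda>x. \<Sum>i\<in>UNIV. convolution (iter_partial_deriv (js @ [i]) (?f i)) G x)"
        by (rule decays_sum)
      moreover have "convolution ?u G = (\<lambda>x. \<Sum>i\<in>UNIV. convolution (iter_partial_deriv (js @ [i]) (?f i)) G x)"
        unfolding iter\<Phi> by (rule ext) (rule convolution_sum[OF Gt Fs])
      ultimately show ?thesis by (simp only:)
    qed
    ultimately have "decays ?q (\<lambda>x. convolution ?u G x + convolution ?u K x)"
      by (intro decays_add)
    moreover have "convolution ?u ?L = (\<lambda>x. convolution ?u G x + convolution ?u K x)"
      unfolding Leq by (rule ext) (rule convolution_add_kernel[OF Gt Kt u])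
    ultimately show ?thesis unfolding iter by (simp only:)
  qed
  moreover have "iter_partial_deriv js (convolution (divergence F) ?L) differentiable (at x)" for js x
    unfolding iter by (rule differentiable_convolution_schwartz[OF Lt schwartz_iter_partial_deriv[OF \<Phi>]])
  ultimately show ?thesis unfolding smooth_decay_def by blast
qed

theorem theorem1:
  fixes F Fp Fs :: "real^'n::finite \<Rightarrow> real^'n"
    and \<Phi> \<phi> :: "real^'n \<Rightarrow> real"
  assumes "CARD('n) \<ge> 2"
    and "\<And>k. schwartz (\<lambda>x. F x $ k)"
    and "\<Phi> = divergence F"
    and "\<phi> = convolution \<Phi> laplace_fundamental"
    and "Fp = gradient \<phi>"
    and "Fs = (\<lambda>x. F x - Fp x)"
  shows
    "(\<forall>x. integrable lborel (\<lambda>y. \<Phi> y * laplace_fundamental (x - y)))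
     \<and> \<phi> differentiable_on UNIV
     \<and> Fp differentiable_on UNIV \<and> Fs differentiable_on UNIV
     \<and> (\<forall>j. partial_deriv j Fp differentiable_on UNIV \<and> partial_deriv j Fs differentiable_on UNIV)
     \<and> (\<lambda>x. \<bar>\<phi> x\<bar>) \<in> O[at_infinity](\<lambda>x. 1 / norm x ^ (CARD('n) - 1))
     \<and> (\<lambda>x. norm (Fp x)) \<in> O[at_infinity](\<lambda>x. 1 / norm x ^ CARD('n))
     \<and> (\<lambda>x. norm (Fs x)) \<in> O[at_infinity](\<lambda>x. 1 / norm x ^ CARD('n))
     \<and> (\<forall>j. (\<lambda>x. norm (partial_deriv j Fp x)) \<in> O[at_infinity](\<lambda>x. 1 / norm x ^ (CARD('n) + 1)))
     \<and> (\<forall>j. (\<lambda>x. norm (partial_deriv j Fs x)) \<in> O[at_infinity](\<lambda>x. 1 / norm x ^ (CARD('n) + 1)))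
     \<and> (\<forall>j k. (\<lambda>x. norm (partial_deriv j (partial_deriv k Fp) x)) \<in> O[at_infinity](\<lambda>x. 1 / norm x ^ (CARD('n) + 2)))
     \<and> (\<forall>j k. (\<lambda>x. norm (partial_deriv j (partial_deriv k Fs) x)) \<in> O[at_infinity](\<lambda>x. 1 / norm x ^ (CARD('n) + 2)))"
proof -
  let ?d = "CARD('n)"
  have \<Phi>: "schwartz \<Phi>"
    unfolding assms(3) divergence_def[abs_def] by (intro schwartz_sum schwartz_partial_deriv assms(2))
  have int: "integrable lborel (\<lambda>y. \<Phi> y * laplace_fundamental (x - y))" for x
    by (rule integrable_schwartz_mult_tempered[OF tempered_laplace_fundamental[OF assms(1)] \<Phi>])
  have \<phi>: "smooth_decay m (?d - 1) \<phi>" for m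
    unfolding assms(3,4) by (rule smooth_decay_divergence_potential[OF assms(1,2)])
  have \<phi>d: "\<phi> differentiable_on UNIV"
    using \<phi>[of 0] by (auto simp: smooth_decay_def differentiable_on_def dest: spec[of _ "[]"])
  have "decays (?d - 1) \<phi>"
    using \<phi>[of 0] by (auto simp: smooth_decay_def)
  hence \<phi>O: "(\<lambda>x. \<bar>\<phi> x\<bar>) \<in> O[at_infinity](\<lambda>x. 1 / norm x ^ (?d - 1))" by (rule decays_bigo)
  \<comment> \<open>The estimate for \<open>\<phi>\<close> is used with order 3: the gradient
    consumes one order and raises the power from d - 1 to d.\<close>
  have "smooth_decay 2 (Suc (?d - 1)) (partial_deriv k \<phi>)" for k
    by (rule smooth_decay_partial_deriv[OF \<phi>])
  hence Fp: "smooth_decay 2 ?d (\<lambda>x. Fp x $ k)" for k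
    using assms(1) unfolding assms(5) by (simp add: gradient_def)
  \<comment> \<open>\<open>F\<close> decays at every rate together with its derivatives, so
    subtracting \<open>Fp\<close> leaves the rate of \<open>Fp\<close>.\<close>
  have Fs: "smooth_decay 2 ?d (\<lambda>x. Fs x $ k)" for k
    unfolding assms(6) vector_minus_component
    by (rule smooth_decay_diff[OF smooth_decay_schwartz[OF assms(2)] Fp])
  \<comment> \<open>Both fields now meet the same hypothesis; the lists \<open>[]\<close>,
    \<open>[j]\<close> and \<open>[j, k]\<close> give the three orders of the claim.\<close>
  have vec: "V differentiable_on UNIV \<and> (\<forall>j. partial_deriv j V differentiable_on UNIV)
      \<and> (\<lambda>x. norm (V x)) \<in> O[at_infinity](\<lambda>x. 1 / norm x ^ ?d)
      \<and> (\<forall>j. (\<lambda>x. norm (partial_deriv j V x)) \<in> O[at_infinity](\<lambda>x. 1 / norm x ^ (?d + 1)))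
      \<and> (\<forall>j k. (\<lambda>x. norm (partial_deriv j (partial_deriv k V) x)) \<in> O[at_infinity](\<lambda>x. 1 / norm x ^ (?d + 2)))"
    if V: "\<And>k. smooth_decay 2 ?d (\<lambda>x. V x $ k)" for V :: "real^'n \<Rightarrow> real^'n"
    using smooth_decay_vec_differentiable[OF V, of "[]"] smooth_decay_vec_differentiable[OF V, of "[j]" for j]
      smooth_decay_vec_bigo[OF V, of "[]"] smooth_decay_vec_bigo[OF V, of "[j]" for j]
      smooth_decay_vec_bigo[OF V, of "[j, k]" for j k]
    by (simp add: numeral_2_eq_2)
  show ?thesis using int \<phi>d \<phi>O vec[OF Fp] vec[OF Fs] by blast
qed

end
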